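(* Assume that the transition potential $W$ is uniformly bounded on $\mathbb X\times\mathbb Y$. Then for every $\Phi$-entropy $D_\Phi$ there exist parameters $\rho\in(0,1)$ and $c>0$ such that for any $n\ge 0$: (i) $$D_\Phi(\pi_{2n},\nu_V)\le\rho^n D_\Phi(\pi_0,\nu_V)\qquad\text{and}\qquad \|\log(d\pi_{2n}/d\nu_V)\|\le c\,\rho^n,$$ and these inequalities remain valid when $(\pi_{2n},\nu_V)$ is replaced by $(\nu_V,\pi_{2n})$, that is, $$D_\Phi(\nu_V,\pi_{2n})\le\rho^n D_\Phi(\nu_V,\pi_0)\qquad\text{and}\qquad \|\log(d\nu_V/d\pi_{2n})\|\le c\,\rho^n;$$ (ii) analogous bounds hold for $(\lambda_U,\pi_{2n+1})$, that is, $$D_\Phi(\pi_{2n+1},\lambda_U)\le\rho^n D_\Phi(\pi_1,\lambda_U),\qquad D_\Phi(\lambda_U,\pi_{2n+1})\le\rho^n D_\Phi(\lambda_U,\pi_1),\qquad \|\log(d\pi_{2n+1}/d\lambda_U)\|\le c\,\rho^n;$$ (iii) $\ \mathrm{Ent}(\mathbb P\,|\,P_{2n})\le c\,\rho^n$.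
   Context: Setting. $(\mathbb X,\lambda)$ and $(\mathbb Y,\nu)$ are locally compact Polish spaces with locally bounded positive measures $\lambda,\nu$. $U:\mathbb X\to\mathbb R$, $V:\mathbb Y\to\mathbb R$, $W:\mathbb X\times\mathbb Y\to\mathbb R$ are measurable, such that $\lambda_U(dx):=e^{-U(x)}\lambda(dx)$ and $\nu_V(dy):=e^{-V(y)}\nu(dy)$ are probability measures and $Q(x,dy):=e^{-W(x,y)}\nu(dy)$ is a Markov kernel. Put $R(y,dx):=e^{-W(x,y)}\lambda(dx)$ (not necessarily Markov). For a kernel $K$, $K(f)(x)=\int K(x,dy)f(y)$ and $(\mu K)(dy)=\int\mu(dx)K(x,dy)$. Relative entropy: $\mathrm{Ent}(\mu_1|\mu_2)=\int\log(d\mu_1/d\mu_2)\,d\mu_1$ ($=+\infty$ if $\mu_1\not\ll\mu_2$). $P_0(d(x,y))=\lambda_U(dx)Q(x,dy)$; $\Pi_{U,V}$ is the set of probability measures on $\mathbb X\times\mathbb Y$ with marginals $\lambda_U,\nu_V$. Standing assumption: some $P\in\Pi_{U,V}$ has $\mathrm{Ent}(P|P_0)<\infty$. The Schrödinger bridge is $\mathbb P=\mathrm{argmin}_{P\in\Pi_{U,V}}\mathrm{Ent}(P|P_0)$. Sinkhorn iterations. $U_0=U$, $V_0=0$, and for $n\ge0$: $U_{2n+1}=U_{2n}=U+\log Q(e^{-V_{2n}})$, $V_{2(n+1)}=V_{2n+1}=V+\log R(e^{-U_{2n}})$. The Sinkhorn transitions are $$S_{2n}(x,dy)=\frac{Q(x,dy)e^{-V_{2n}(y)}}{Q(e^{-V_{2n}})(x)},\qquad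 S_{2n+1}(y,dx)=\frac{R(y,dx)e^{-U_{2n+1}(x)}}{R(e^{-U_{2n+1}})(y)},$$ so $S_0=Q$. The marginals are $\pi_{2n}=\lambda_US_{2n}$ (on $\mathbb Y$), $\pi_{2n+1}=\nu_VS_{2n+1}$ (on $\mathbb X$), and the Sinkhorn bridges are $P_n(d(x,y))=e^{-W(x,y)}e^{-U_n(x)}e^{-V_n(y)}\lambda(dx)\nu(dy)$; thus $P_{2n}(d(x,y))=\lambda_U(dx)S_{2n}(x,dy)$. $\Phi$-entropy. $\Phi:\mathbb R_+^2\to\mathbb R\cup\{+\infty\}$ is convex with $\Phi(au,av)=a\Phi(u,v)$ for all $a\in\mathbb R_+$ and $\Phi(1,1)=0$; $D_\Phi(\mu_1,\mu_2)=\int\Phi\big(\tfrac{d\mu_1}{d\gamma},\tfrac{d\mu_2}{d\gamma}\big)d\gamma$ for any dominating measure $\gamma$ (independent of $\gamma$). $\|f\|=\sup|f|$ is the supremum norm.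
   Formalization: The two log-norm bounds in (i) are claimed at n=0 only if ‖log(dπ_0/dν_V)‖ (resp. ‖log(dν_V/dπ_0)‖) is finite; with unbounded V this norm can be infinite (W=0, π_0=ν gives log(dπ_0/dν_V)=V), so no finite c works there. *)

theory Defs
  imports "HOL-Probability.Probability"
begin

section \<open>Relative entropy, \<open>\<Phi>\<close>-entropies and logarithmic densities\<close>

text \<open>
  The negative part of \<open>log (d\<mu>\<^sub>1/d\<mu>\<^sub>2)\<close> is always \<open>\<mu>\<^sub>1\<close>-integrable when \<open>\<mu>\<^sub>1 \<lless> \<mu>\<^sub>2\<close>
  are finite measures (\<open>t log t \<ge> -1/e\<close>), so non-integrability means that the integral
  is \<open>+\<infinity>\<close>.  The library's \<open>KL_divergence b M N\<close> takes the reference measure first.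
\<close>
definition Ent :: "'a measure \<Rightarrow> 'a measure \<Rightarrow> ereal" where
  "Ent \<mu>1 \<mu>2 =
     (if absolutely_continuous \<mu>2 \<mu>1 \<and> integrable \<mu>1 (entropy_density (exp 1) \<mu>2 \<mu>1)
      then ereal (KL_divergence (exp 1) \<mu>2 \<mu>1) else \<infinity>)"

text \<open>
  Functions \<open>\<Phi> : [0,\<infinity>)\<^sup>2 \<rightarrow> \<real> \<union> {+\<infinity>}\<close>; values outside the quadrant are irrelevant.
  In \<open>ereal\<close>, \<open>0 * \<infinity> = 0\<close>; in particular homogeneity at \<open>a = 0\<close> says \<open>\<Phi> 0 0 = 0\<close>.
\<close>
definition entropy_function :: "(real \<Rightarrow> real \<Rightarrow> ereal) \<Rightarrow> bool" where
  "entropy_function \<Phi> \<longleftrightarrow>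
     (\<forall>u\<ge>0. \<forall>v\<ge>0. \<Phi> u v \<noteq> -\<infinity>) \<and>
     (\<forall>u\<ge>0. \<forall>v\<ge>0. \<forall>u'\<ge>0. \<forall>v'\<ge>0. \<forall>t\<in>{0..1}.
        \<Phi> ((1 - t) * u + t * u') ((1 - t) * v + t * v')
          \<le> ereal (1 - t) * \<Phi> u v + ereal t * \<Phi> u' v') \<and>
     (\<forall>a\<ge>0. \<forall>u\<ge>0. \<forall>v\<ge>0. \<Phi> (a * u) (a * v) = ereal a * \<Phi> u v) \<and>
     \<Phi> 1 1 = 0"

text \<open>\<open>e2ennreal\<close> sends negative arguments to 0, so this is \<open>\<integral>f\<^sup>+ - \<integral>f\<^sup>-\<close>.\<close>
definition ereal_integral :: "'a measure \<Rightarrow> ('a \<Rightarrow> ereal) \<Rightarrow> ereal" where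
  "ereal_integral M f =
     enn2ereal (\<integral>\<^sup>+x. e2ennreal (f x) \<partial>M) - enn2ereal (\<integral>\<^sup>+x. e2ennreal (- f x) \<partial>M)"

definition dominating :: "'a measure \<Rightarrow> 'a measure \<Rightarrow> 'a measure \<Rightarrow> bool" where
  "dominating \<mu>1 \<mu>2 \<gamma> \<longleftrightarrow>
     sigma_finite_measure \<gamma> \<and> sets \<gamma> = sets \<mu>1 \<and> sets \<gamma> = sets \<mu>2 \<and>
     absolutely_continuous \<gamma> \<mu>1 \<and> absolutely_continuous \<gamma> \<mu>2"

text \<open>
  By homogeneity of \<open>\<Phi>\<close> the value does not depend on the dominating measure, so any choice
  will do.  A convex \<open>\<Phi>\<close> satisfies \<open>\<Phi> u v \<ge> - C * (u + v)\<close> on the quadrant, so for finite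
  measures the negative part has a finite integral.
\<close>
definition Phi_entropy ::
    "(real \<Rightarrow> real \<Rightarrow> ereal) \<Rightarrow> 'a measure \<Rightarrow> 'a measure \<Rightarrow> ereal" where
  "Phi_entropy \<Phi> \<mu>1 \<mu>2 =
     (let \<gamma> = (SOME \<gamma>. dominating \<mu>1 \<mu>2 \<gamma>)
      in ereal_integral \<gamma>
           (\<lambda>x. \<Phi> (enn2real (RN_deriv \<gamma> \<mu>1 x)) (enn2real (RN_deriv \<gamma> \<mu>2 x))))"

text \<open>The true logarithm on \<open>[0,\<infinity>]\<close>, unlike \<open>ln\<close> on the reals, where \<open>ln 0 = 0\<close>.\<close>
definition log_ennreal :: "ennreal \<Rightarrow> ereal" where
  "log_ennreal r = (if r = 0 then -\<infinity> else if r = \<infinity> then \<infinity> else ereal (ln (enn2real r)))"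

text \<open>
  \<open>\<parallel>log (d\<mu>\<^sub>1/d\<mu>\<^sub>2)\<parallel>\<close>.  A Radon-Nikodym derivative is only determined up to null sets, so its
  supremum norm is the essential one (the least supremum norm of a version).
\<close>
definition log_deriv_norm :: "'a measure \<Rightarrow> 'a measure \<Rightarrow> ereal" where
  "log_deriv_norm \<mu>1 \<mu>2 =
     (if absolutely_continuous \<mu>2 \<mu>1
      then esssup \<mu>2 (\<lambda>x. \<bar>log_ennreal (RN_deriv \<mu>2 \<mu>1 x)\<bar>) else \<infinity>)"


section \<open>Schroedinger bridges and Sinkhorn iterations\<close>

text \<open>
  \<open>\<Lambda>\<close> is the reference measure on the first space (\<open>\<lambda>\<close> being reserved for abstraction), and
  \<open>tilt \<mu> F\<close> is \<open>\<mu>\<^sub>F(dx) = exp (-F(x)) \<mu>(dx)\<close>.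
\<close>
definition tilt :: "'a measure \<Rightarrow> ('a \<Rightarrow> real) \<Rightarrow> 'a measure" where
  "tilt \<mu> F = density \<mu> (\<lambda>x. ennreal (exp (- F x)))"

definition kernel_Q :: "'b measure \<Rightarrow> ('a \<Rightarrow> 'b \<Rightarrow> real) \<Rightarrow> 'a \<Rightarrow> 'b measure" where
  "kernel_Q \<nu> W x = tilt \<nu> (\<lambda>y. W x y)"

definition kernel_R :: "'a measure \<Rightarrow> ('a \<Rightarrow> 'b \<Rightarrow> real) \<Rightarrow> 'b \<Rightarrow> 'a measure" where
  "kernel_R \<Lambda> W y = tilt \<Lambda> (\<lambda>x. W x y)"

definition kernel_apply :: "('a \<Rightarrow> 'b measure) \<Rightarrow> ('b \<Rightarrow> real) \<Rightarrow> 'a \<Rightarrow> real" where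
  "kernel_apply K f x = (\<integral>y. f y \<partial>K x)"

text \<open>\<open>K(x,dy) exp (-F(y)) / K(exp (-F))(x)\<close>\<close>
definition normalized_kernel :: "('a \<Rightarrow> 'b measure) \<Rightarrow> ('b \<Rightarrow> real) \<Rightarrow> 'a \<Rightarrow> 'b measure" where
  "normalized_kernel K F x =
     density (K x) (\<lambda>y. ennreal (exp (- F y) / kernel_apply K (\<lambda>z. exp (- F z)) x))"

definition couplings :: "'a measure \<Rightarrow> 'b measure \<Rightarrow> ('a \<times> 'b) measure set" where
  "couplings M N = {P. prob_space P \<and> sets P = sets (M \<Otimes>\<^sub>M N) \<and>
                       distr P M fst = M \<and> distr P N snd = N}"

text \<open>
  The pair \<open>(U\<^sub>n, V\<^sub>n)\<close>: odd steps update \<open>V\<close> and keep \<open>U\<close>, even steps update \<open>U\<close> and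
  keep \<open>V\<close>.  The relation \<open>U\<^sub>0 = U + log Q(exp (-V\<^sub>0))\<close> holds because \<open>Q\<close> is Markov.
\<close>
primrec sinkhorn_potentials ::
    "'a measure \<Rightarrow> 'b measure \<Rightarrow> ('a \<Rightarrow> real) \<Rightarrow> ('b \<Rightarrow> real) \<Rightarrow> ('a \<Rightarrow> 'b \<Rightarrow> real)
      \<Rightarrow> nat \<Rightarrow> ('a \<Rightarrow> real) \<times> ('b \<Rightarrow> real)" where
  "sinkhorn_potentials \<Lambda> \<nu> U V W 0 = (U, \<lambda>y. 0)"
| "sinkhorn_potentials \<Lambda> \<nu> U V W (Suc n) =
     (let (u, v) = sinkhorn_potentials \<Lambda> \<nu> U V W n in
      if even n
      then (u, \<lambda>y. V y + ln (kernel_apply (kernel_R \<Lambda> W) (\<lambda>x. exp (- u x)) y))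
      else (\<lambda>x. U x + ln (kernel_apply (kernel_Q \<nu> W) (\<lambda>y. exp (- v y)) x), v))"

definition sinkhorn_U where
  "sinkhorn_U \<Lambda> \<nu> U V W n = fst (sinkhorn_potentials \<Lambda> \<nu> U V W n)"

definition sinkhorn_V where
  "sinkhorn_V \<Lambda> \<nu> U V W n = snd (sinkhorn_potentials \<Lambda> \<nu> U V W n)"

text \<open>
  Even and odd transitions (and marginals) live on different spaces, so the sequences
  \<open>S\<^sub>n\<close> and \<open>\<pi>\<^sub>n\<close> are split: the suffix \<open>even\<close> at \<open>n\<close> stands for index \<open>2 n\<close>, the suffix \<open>odd\<close>
  at \<open>n\<close> for index \<open>2 n + 1\<close>.
\<close>
definition sinkhorn_S_even where
  "sinkhorn_S_even \<Lambda> \<nu> U V W n =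
     normalized_kernel (kernel_Q \<nu> W) (sinkhorn_V \<Lambda> \<nu> U V W (2 * n))"

definition sinkhorn_S_odd where
  "sinkhorn_S_odd \<Lambda> \<nu> U V W n =
     normalized_kernel (kernel_R \<Lambda> W) (sinkhorn_U \<Lambda> \<nu> U V W (2 * n + 1))"

definition sinkhorn_pi_even where
  "sinkhorn_pi_even \<Lambda> \<nu> U V W n = tilt \<Lambda> U \<bind> sinkhorn_S_even \<Lambda> \<nu> U V W n"

definition sinkhorn_pi_odd where
  "sinkhorn_pi_odd \<Lambda> \<nu> U V W n = tilt \<nu> V \<bind> sinkhorn_S_odd \<Lambda> \<nu> U V W n"

definition sinkhorn_bridge where
  "sinkhorn_bridge \<Lambda> \<nu> U V W n =
     density (\<Lambda> \<Otimes>\<^sub>M \<nu>)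
       (\<lambda>(x, y). ennreal (exp (- W x y) * exp (- sinkhorn_U \<Lambda> \<nu> U V W n x)
                                        * exp (- sinkhorn_V \<Lambda> \<nu> U V W n y)))"

text \<open>The reference measure \<open>P\<^sub>0(d(x,y)) = \<lambda>\<^sub>U(dx) Q(x,dy)\<close> is the Sinkhorn bridge of index 0.\<close>
definition schroedinger_bridge where
  "schroedinger_bridge \<Lambda> \<nu> U V W =
     arg_min_on (\<lambda>P. Ent P (sinkhorn_bridge \<Lambda> \<nu> U V W 0)) (couplings (tilt \<Lambda> U) (tilt \<nu> V))"

end

theory Submission
  imports Defs
begin

text \<open>
  Write \<open>M = \<lambda>\<^sub>U\<close>, \<open>N = \<nu>\<^sub>V\<close> and \<open>k = exp (- W)\<close>; boundedness of \<open>W\<close> pinches \<open>k\<close> between \<open>a\<close> and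
  \<open>1/a\<close> for some \<open>0 < a < 1\<close>. Relative to these probability measures a Sinkhorn half-step sends a
  positive weight \<open>g\<close> to \<open>scaling k N g = 1 / \<integral>k(\<cdot>,y) g(y) N(dy)\<close>, and the opposite half-step does the
  same with the two spaces exchanged. Starting from \<open>g\<^sub>0 = exp V\<close>, the iterates \<open>f\<^sub>n = scaling g\<^sub>n\<close> and
  \<open>g\<^sub>n\<^sub>+\<^sub>1 = scaling f\<^sub>n\<close> are \<open>exp (U - U\<^sub>2\<^sub>n)\<close> and \<open>exp (V - V\<^sub>2\<^sub>n\<^sub>+\<^sub>1)\<close>, so that
  \<open>d\<pi>\<^sub>2\<^sub>n/d\<nu>\<^sub>V = g\<^sub>n/g\<^sub>n\<^sub>+\<^sub>1\<close> and \<open>d\<pi>\<^sub>2\<^sub>n\<^sub>+\<^sub>1/d\<lambda>\<^sub>U = f\<^sub>n/f\<^sub>n\<^sub>+\<^sub>1\<close>.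

  \<open>\<Phi>\<close>-entropies. The transition \<open>S\<^sub>2\<^sub>n\<^sub>+\<^sub>1\<close> carries the pair \<open>(\<nu>\<^sub>V, \<pi>\<^sub>2\<^sub>n)\<close> to \<open>(\<pi>\<^sub>2\<^sub>n\<^sub>+\<^sub>1, \<lambda>\<^sub>U)\<close>, and
  \<open>S\<^sub>2\<^sub>n\<^sub>+\<^sub>2\<close> carries \<open>(\<lambda>\<^sub>U, \<pi>\<^sub>2\<^sub>n\<^sub>+\<^sub>1)\<close> to \<open>(\<pi>\<^sub>2\<^sub>n\<^sub>+\<^sub>2, \<nu>\<^sub>V)\<close>. The bounds on \<open>k\<close> give every transition a
  Doeblin minorization by \<open>a\<^sup>2\<close> times a fixed probability measure. On the minorizing part both images
  have the same density, where \<open>\<Phi>\<close> vanishes; on the rest Jensen's inequality applies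
  (\<open>entropy_contraction_step\<close>). Each half-step thus gains a constant factor below one.

  Logarithms. The ratio \<open>f\<^sub>n\<^sub>+\<^sub>1/f\<^sub>n\<close> is the image of \<open>f\<^sub>n/f\<^sub>n\<^sub>-\<^sub>1\<close> under two minorized Markov kernels, each
  of which shrinks the distance between its upper and its lower bound (\<open>scaling_contraction\<close>). The
  ratio stays away from zero, and the mean of its inverse is one, so it tends to one uniformly at
  geometric speed. Summing up, \<open>ln f\<^sub>n\<close> and \<open>ln g\<^sub>n\<close> converge geometrically to the logarithms of a fixed
  point \<open>(f, g)\<close> of the two half-steps (\<open>scaling_limit\<close>).

  The bridge. At the fixed point, \<open>P\<^sub>* = k f g (M \<Otimes> N)\<close> is a coupling of \<open>M\<close> and \<open>N\<close>. Since
  \<open>log (dP\<^sub>*/dP\<^sub>2\<^sub>n)\<close> is a function of \<open>x\<close> plus a function of \<open>y\<close>, its integral is the same against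
  every coupling, whence \<open>Ent(P|P\<^sub>2\<^sub>n) = Ent(P|P\<^sub>*) + const\<close> for all couplings \<open>P\<close>
  (\<open>Ent_change_bridge\<close>). For \<open>n = 0\<close> this shows that \<open>P\<^sub>*\<close> attains the minimum and that a minimizer
  has entropy at most zero relative to \<open>P\<^sub>*\<close>; for general \<open>n\<close> the constant is bounded by the uniform
  distance between the logarithms of the iterates and of their limits.
\<close>

section \<open>Extended-valued convex functions and Jensen's inequality\<close>

definition ext_convex :: "(real \<Rightarrow> ereal) \<Rightarrow> bool" where
  "ext_convex \<phi> \<longleftrightarrow> (\<forall>t>0. \<phi> t \<noteq> -\<infinity>) \<and>
     (\<forall>s>0. \<forall>t>0. \<forall>l\<in>{0..1}. \<phi> ((1 - l) * s + l * t) \<le> ereal (1 - l) * \<phi> s + ereal l * \<phi> t)"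

lemma ext_convexD:
  assumes "ext_convex \<phi>" "0 < s" "0 < t" "0 \<le> l" "l \<le> 1"
  shows "\<phi> ((1 - l) * s + l * t) \<le> ereal (1 - l) * \<phi> s + ereal l * \<phi> t"
  using assms unfolding ext_convex_def by auto

text \<open>
  The slope \<open>c\<close> is the supremum of the left difference quotients at \<open>m\<close>; finiteness of \<open>\<phi>\<close> at a point
  on the right of \<open>m\<close> bounds them.
\<close>
lemma ext_convex_support_line:
  assumes conv: "ext_convex \<phi>" and "0 < s0" "s0 < m" "m < t0"
    and fin: "\<phi> s0 \<noteq> \<infinity>" "\<phi> t0 \<noteq> \<infinity>"
  obtains c y where "\<phi> m = ereal y" "\<And>t. 0 < t \<Longrightarrow> ereal (y + c * (t - m)) \<le> \<phi> t"
proof -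
  define r where "r t = real_of_ereal (\<phi> t)" for t
  have not_minf: "\<phi> t \<noteq> -\<infinity>" if "0 < t" for t
    using conv that unfolding ext_convex_def by auto
  have r: "\<phi> t = ereal (r t)" if "0 < t" "\<phi> t \<noteq> \<infinity>" for t
    using that not_minf[of t] unfolding r_def by (cases "\<phi> t") auto
  have between: "\<phi> m \<le> ereal ((t - m) / (t - s) * r s + (m - s) / (t - s) * r t)"
    if "0 < s" "s < m" "m < t" "\<phi> s \<noteq> \<infinity>" "\<phi> t \<noteq> \<infinity>" for s t
  proof -
    define l where "l = (m - s) / (t - s)"
    have l: "0 \<le> l" "l \<le> 1" "1 - l = (t - m) / (t - s)"
      using that unfolding l_def by (auto simp: field_simps)
    have m: "(1 - l) * s + l * t = m"
      using that unfolding l(3) unfolding l_def by (simp add: divide_simps) (simp add: algebra_simps)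
    show ?thesis
      using ext_convexD[OF conv, of s t l] that l m r[of s] r[of t]
      by (simp add: l_def[symmetric])
  qed
  have fin_m: "\<phi> m \<noteq> \<infinity>"
    using between[of s0 t0] assms by auto
  have slopes: "(r m - r s) / (m - s) \<le> (r t - r m) / (t - m)"
    if "0 < s" "s < m" "m < t" "\<phi> s \<noteq> \<infinity>" "\<phi> t \<noteq> \<infinity>" for s t
  proof -
    have "r m \<le> (t - m) / (t - s) * r s + (m - s) / (t - s) * r t"
      using between[OF that] r[of m] fin_m that by auto
    then have "r m * (t - s) \<le> ((t - m) / (t - s) * r s + (m - s) / (t - s) * r t) * (t - s)"
      using that by (intro mult_right_mono) auto
    also have "\<dots> = (t - m) * r s + (m - s) * r t"
      using that by (simp add: distrib_right)
    finally have "r m * (t - s) \<le> (t - m) * r s + (m - s) * r t" .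
    then show ?thesis
      using that by (simp add: field_simps)
  qed
  define A where "A = (\<lambda>s. (r m - r s) / (m - s)) ` {s. 0 < s \<and> s < m \<and> \<phi> s \<noteq> \<infinity>}"
  define c where "c = Sup A"
  have A: "A \<noteq> {}" "bdd_above A"
    using assms slopes[of _ t0] unfolding A_def by (auto intro!: bdd_aboveI2)
  show ?thesis
  proof
    show "\<phi> m = ereal (r m)"
      using r[of m] fin_m assms by auto
    fix t :: real assume t: "0 < t"
    show "ereal (r m + c * (t - m)) \<le> \<phi> t"
    proof (cases "\<phi> t = \<infinity>")
      case False
      consider "t < m" | "t = m" | "m < t" by linarith
      then have "r m + c * (t - m) \<le> r t"
      proof cases
        case 1
        then have "(r m - r t) / (m - t) \<le> c"
          unfolding c_def using t False A by (intro cSup_upper) (auto simp: A_def)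
        then show ?thesis using 1 by (simp add: field_simps)
      next
        case 3
        then have "c \<le> (r t - r m) / (t - m)"
          unfolding c_def using t False A(1) slopes
          by (intro cSup_least) (auto simp: A_def)
        then show ?thesis using 3 by (simp add: field_simps)
      qed simp
      then show ?thesis using r[OF t False] by simp
    qed simp
  qed
qed

text \<open>Sublevel sets of a convex function are intervals.\<close>
lemma borel_measurable_ext_convex:
  assumes conv: "ext_convex \<phi>" and [measurable]: "p \<in> borel_measurable M"
    and pos: "\<And>x. x \<in> space M \<Longrightarrow> 0 < p x"
  shows "(\<lambda>x. \<phi> (p x)) \<in> borel_measurable M"
proof -
  have sublevel: "{t. 0 < t \<and> \<phi> t \<le> a} \<in> sets borel" for a
  proof -
    have "is_interval {t. 0 < t \<and> \<phi> t \<le> a}"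
      unfolding is_interval_convex_1 convex_alt
    proof (intro ballI allI impI)
      fix s t l :: real
      assume st: "s \<in> {t. 0 < t \<and> \<phi> t \<le> a}" "t \<in> {t. 0 < t \<and> \<phi> t \<le> a}" and l: "0 \<le> l \<and> l \<le> 1"
      have "0 < (1 - l) * s + l * t"
      proof (cases "l = 0")
        case False
        then show ?thesis using st l by (intro add_nonneg_pos) auto
      qed (use st in simp)
      moreover have "\<phi> ((1 - l) * s + l * t) \<le> a"
      proof -
        have "\<phi> ((1 - l) * s + l * t) \<le> ereal (1 - l) * \<phi> s + ereal l * \<phi> t"
          using st l by (intro ext_convexD[OF conv]) auto
        also have "\<dots> \<le> ereal (1 - l) * a + ereal l * a"
          using st l by (intro add_mono ereal_mult_left_mono) auto
        also have "\<dots> = (ereal (1 - l) + ereal l) * a"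
          using l by (intro ereal_left_distrib[symmetric]) auto
        finally show ?thesis by simp
      qed
      ultimately show "(1 - l) *\<^sub>R s + l *\<^sub>R t \<in> {t. 0 < t \<and> \<phi> t \<le> a}" by simp
    qed
    then show ?thesis
      by (rule real_interval_borel_measurable)
  qed
  show ?thesis
  proof (rule borel_measurableI_le)
    fix a
    have "{x \<in> space M. \<phi> (p x) \<le> a} = p -` {t. 0 < t \<and> \<phi> t \<le> a} \<inter> space M"
      using pos by auto
    also have "\<dots> \<in> sets M"
      using sublevel by (rule measurable_sets[OF assms(2)])
    finally show "{x \<in> space M. \<phi> (p x) \<le> a} \<in> sets M" .
  qed
qed

lemma ennreal_integral_le_nn_integral:
  fixes f :: "'a \<Rightarrow> real"
  assumes f: "integrable M f"
  shows "ennreal (\<integral>x. f x \<partial>M) \<le> (\<integral>\<^sup>+x. ennreal (f x) \<partial>M)"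
proof -
  have fin: "(\<integral>\<^sup>+x. ennreal (f x) \<partial>M) \<noteq> \<infinity>"
    using f by (simp add: real_integrable_def)
  have "(\<integral>x. f x \<partial>M) \<le> enn2real (\<integral>\<^sup>+x. ennreal (f x) \<partial>M)"
    by (subst real_lebesgue_integral_def[OF f]) simp
  then show ?thesis
    using fin by (metis ennreal_enn2real ennreal_leI infinity_ennreal_def less_top)
qed

text \<open>
  The mean \<open>m\<close> may sit on the boundary of the interval where \<open>\<phi>\<close> is finite, and there \<open>\<phi>\<close> need not have
  a support line, nor be lower semicontinuous. In that case \<open>p\<close> lies almost everywhere on one side of
  its own mean as soon as the right-hand side is finite, hence \<open>p = m\<close> almost everywhere.
\<close>
lemma jensen_ext_convex:
  assumes conv: "ext_convex \<phi>" and nn: "\<And>t. 0 < t \<Longrightarrow> 0 \<le> \<phi> t"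
    and "finite_measure M" and M: "0 < measure M (space M)"
    and p[measurable]: "p \<in> borel_measurable M" "integrable M p" and pos: "\<And>x. x \<in> space M \<Longrightarrow> 0 < p x"
    and m: "m = (\<integral>x. p x \<partial>M) / measure M (space M)"
  shows "ennreal (measure M (space M)) * e2ennreal (\<phi> m) \<le> (\<integral>\<^sup>+x. e2ennreal (\<phi> (p x)) \<partial>M)"
proof (cases "(\<integral>\<^sup>+x. e2ennreal (\<phi> (p x)) \<partial>M) = \<infinity>")
  case False
  interpret finite_measure M by fact
  note [measurable] = borel_measurable_ext_convex[OF conv p(1) pos]
  have mass: "emeasure M (space M) = ennreal (measure M (space M))"
    by (simp add: emeasure_eq_measure)
  have finite_AE: "AE x in M. \<phi> (p x) \<noteq> \<infinity>"
    using nn_integral_PInf_AE[OF _ False] by (auto elim!: eventually_mono)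
  have int_p: "(\<integral>x. p x \<partial>M) = m * measure M (space M)"
    using M m by simp
  show ?thesis
  proof (cases "\<exists>s0 t0. 0 < s0 \<and> s0 < m \<and> m < t0 \<and> \<phi> s0 \<noteq> \<infinity> \<and> \<phi> t0 \<noteq> \<infinity>")
    case True
    then obtain s0 t0 where "0 < s0" "s0 < m" "m < t0" "\<phi> s0 \<noteq> \<infinity>" "\<phi> t0 \<noteq> \<infinity>" by auto
    then obtain c y where y: "\<phi> m = ereal y" and
      line: "\<And>t. 0 < t \<Longrightarrow> ereal (y + c * (t - m)) \<le> \<phi> t"
      by (rule ext_convex_support_line[OF conv]) blast
    have "0 \<le> y" using nn[of m] y \<open>0 < s0\<close> \<open>s0 < m\<close> by simp
    have int: "integrable M (\<lambda>x. y + c * (p x - m))"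
      by (intro Bochner_Integration.integrable_add integrable_mult_right Bochner_Integration.integrable_diff p)
         auto
    have "(\<integral>x. y + c * (p x - m) \<partial>M) = y * measure M (space M)"
      using p(2) int_p by (subst Bochner_Integration.integral_add) auto
    then have "ennreal (measure M (space M)) * e2ennreal (\<phi> m) = ennreal (\<integral>x. y + c * (p x - m) \<partial>M)"
      using y \<open>0 \<le> y\<close> M by (simp add: ennreal_mult' mult.commute)
    also have "\<dots> \<le> (\<integral>\<^sup>+x. ennreal (y + c * (p x - m)) \<partial>M)"
      using int by (rule ennreal_integral_le_nn_integral)
    also have "\<dots> \<le> (\<integral>\<^sup>+x. e2ennreal (\<phi> (p x)) \<partial>M)"
      using e2ennreal_mono[OF line[OF pos]] by (intro nn_integral_mono) auto
    finally show ?thesis .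
  next
    case no_line: False
    have side: "(AE x in M. p x \<ge> m) \<or> (AE x in M. p x \<le> m)"
    proof (cases "\<exists>s0. 0 < s0 \<and> s0 < m \<and> \<phi> s0 \<noteq> \<infinity>")
      case True
      then have "\<phi> t = \<infinity>" if "m < t" for t using no_line that by auto
      then have "AE x in M. p x \<le> m" using finite_AE by (auto elim!: eventually_mono simp: not_le[symmetric])
      then show ?thesis ..
    next
      case False
      then have "AE x in M. p x \<ge> m" using finite_AE AE_space pos by (auto elim!: eventually_mono[OF eventually_conj] simp: not_le[symmetric])
      then show ?thesis ..
    qed
    have zero: "(\<integral>x. p x - m \<partial>M) = 0"
      using int_p p(2) by simp
    have "AE x in M. p x = m"
      using side
    proof
      assume "AE x in M. p x \<ge> m"
      then have "AE x in M. p x - m = 0"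
        using zero p(2) by (subst integral_nonneg_eq_0_iff_AE[symmetric]) (auto elim: eventually_mono)
      then show ?thesis by auto
    next
      assume "AE x in M. p x \<le> m"
      moreover have "(\<integral>x. m - p x \<partial>M) = 0" using int_p p(2) by simp
      ultimately have "AE x in M. m - p x = 0"
        using p(2) by (subst integral_nonneg_eq_0_iff_AE[symmetric]) (auto elim: eventually_mono)
      then show ?thesis by auto
    qed
    then have "(\<integral>\<^sup>+x. e2ennreal (\<phi> (p x)) \<partial>M) = (\<integral>\<^sup>+x. e2ennreal (\<phi> m) \<partial>M)"
      by (intro nn_integral_cong_AE) auto
    then show ?thesis
      by (simp add: mass mult.commute)
  qed
qed simp

text \<open>
  The negative part of \<open>F\<close> is dominated by that of \<open>h\<close>, so its integral is finite and the difference
  defining the left-hand side is never \<open>\<infinity> - \<infinity>\<close>. This is how an entropy becomes a nonnegative integral.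
\<close>
lemma ereal_integral_eq_integral_plus_nn_integral:
  fixes h :: "'a \<Rightarrow> real" and G :: "'a \<Rightarrow> ennreal"
  assumes h: "integrable M h" and G[measurable]: "G \<in> borel_measurable M"
    and F: "\<And>x. x \<in> space M \<Longrightarrow> F x = ereal (h x) + enn2ereal (G x)"
  shows "ereal_integral M F = ereal (\<integral>x. h x \<partial>M) + enn2ereal (\<integral>\<^sup>+x. G x \<partial>M)"
proof -
  have [measurable]: "h \<in> borel_measurable M" using h by auto
  have [measurable]: "F \<in> borel_measurable M"
    by (subst measurable_cong[OF F]) auto
  define Fp Fn where "Fp = (\<integral>\<^sup>+x. e2ennreal (F x) \<partial>M)" and "Fn = (\<integral>\<^sup>+x. e2ennreal (- F x) \<partial>M)"
  obtain hp hn where hp: "(\<integral>\<^sup>+x. ennreal (h x) \<partial>M) = ennreal hp" "0 \<le> hp"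
    and hn: "(\<integral>\<^sup>+x. ennreal (- h x) \<partial>M) = ennreal hn" "0 \<le> hn"
    and hh: "(\<integral>x. h x \<partial>M) = hp - hn"
  proof
    show "(\<integral>\<^sup>+x. ennreal (h x) \<partial>M) = ennreal (enn2real (\<integral>\<^sup>+x. ennreal (h x) \<partial>M))"
      "(\<integral>\<^sup>+x. ennreal (- h x) \<partial>M) = ennreal (enn2real (\<integral>\<^sup>+x. ennreal (- h x) \<partial>M))"
      using h by (auto simp: real_integrable_def less_top)
  qed (auto simp: real_lebesgue_integral_def[OF h])
  have "Fn \<le> (\<integral>\<^sup>+x. ennreal (- h x) \<partial>M)"
    unfolding Fn_def
  proof (intro nn_integral_mono)
    fix x assume "x \<in> space M"
    then have "- F x \<le> ereal (- h x)"
      using F[of x] by (cases "G x") (auto simp: enn2ereal_ennreal)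
    from e2ennreal_mono[OF this] show "e2ennreal (- F x) \<le> ennreal (- h x)" by simp
  qed
  then obtain fn where fn: "Fn = ennreal fn" "0 \<le> fn"
    using hn by (cases Fn) (auto simp: top_unique)
  have "Fp + (\<integral>\<^sup>+x. ennreal (- h x) \<partial>M) = (\<integral>\<^sup>+x. G x \<partial>M) + (\<integral>\<^sup>+x. ennreal (h x) \<partial>M) + Fn"
    unfolding Fp_def Fn_def
  proof (subst nn_integral_add[symmetric]; simp?)+
    show "(\<integral>\<^sup>+x. e2ennreal (F x) + ennreal (- h x) \<partial>M) =
        (\<integral>\<^sup>+x. G x + ennreal (h x) + e2ennreal (- F x) \<partial>M)"
    proof (intro nn_integral_cong)
      fix x assume "x \<in> space M"
      then show "e2ennreal (F x) + ennreal (- h x) = G x + ennreal (h x) + e2ennreal (- F x)"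
      proof (cases "G x")
        case (real g)
        then show ?thesis using F[OF \<open>x \<in> space M\<close>]
          by (auto simp: enn2ereal_ennreal ennreal_plus_if ennreal_neg)
      qed (auto simp: F)
    qed
  qed
  then have "Fp + ennreal hn = (\<integral>\<^sup>+x. G x \<partial>M) + ennreal hp + ennreal fn"
    by (simp add: hp hn fn)
  then show ?thesis
    unfolding ereal_integral_def Fp_def[symmetric] Fn_def[symmetric] fn hh using hp(2) hn(2) fn(2)
    by (cases Fp; cases "\<integral>\<^sup>+x. G x \<partial>M")
       (auto simp: enn2ereal_ennreal ennreal_plus[symmetric] simp del: ennreal_plus)
qed

section \<open>Contraction of entropies under a minorized transition\<close>

lemma e2ennreal_ereal_mult: "0 \<le> r \<Longrightarrow> e2ennreal (ereal r * z) = ennreal r * e2ennreal z"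
  by (cases z; cases "r = 0")
     (auto simp: ennreal_mult ennreal_mult' ennreal_mult'' ennreal_mult_top ennreal_neg mult_le_0_iff e2ennreal_neg)

lemma (in prob_space) has_bochner_integral_const: "has_bochner_integral M (\<lambda>_. c :: real) c"
  by (simp add: has_bochner_integral_iff prob_space)

lemma entropy_function_swap: "entropy_function \<Phi> \<Longrightarrow> entropy_function (\<lambda>u v. \<Phi> v u)"
  unfolding entropy_function_def by auto

context
  fixes \<Phi> assumes \<Phi>: "entropy_function \<Phi>"
begin

lemma entropy_function_1_1: "\<Phi> 1 1 = 0"
  using \<Phi> by (simp add: entropy_function_def)

lemma entropy_function_homogeneous:
  "0 \<le> a \<Longrightarrow> 0 \<le> u \<Longrightarrow> 0 \<le> v \<Longrightarrow> \<Phi> (a * u) (a * v) = ereal a * \<Phi> u v"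
  using \<Phi> by (simp add: entropy_function_def)

lemma ext_convex_entropy_function: "ext_convex (\<Phi> 1)"
proof -
  have conv: "\<forall>u\<ge>0. \<forall>v\<ge>0. \<forall>u'\<ge>0. \<forall>v'\<ge>0. \<forall>t\<in>{0..1}. \<Phi> ((1 - t) * u + t * u') ((1 - t) * v + t * v')
      \<le> ereal (1 - t) * \<Phi> u v + ereal t * \<Phi> u' v'"
    using \<Phi> unfolding entropy_function_def by (elim conjE)
  have "\<Phi> 1 ((1 - l) * s + l * t) \<le> ereal (1 - l) * \<Phi> 1 s + ereal l * \<Phi> 1 t"
    if "0 < s" "0 < t" "l \<in> {0..1}" for s t l
    using conv[rule_format, of 1 s 1 t l] that by simp
  then show ?thesis
    using \<Phi> unfolding ext_convex_def entropy_function_def by auto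
qed

lemma entropy_function_eq: "0 < u \<Longrightarrow> 0 \<le> v \<Longrightarrow> \<Phi> u v = ereal u * \<Phi> 1 (v / u)"
  using entropy_function_homogeneous[of u 1 "v / u"] by simp

end

text \<open>
  Here \<open>s\<close> is the density of a Markov kernel from \<open>N\<close> to \<open>M\<close> that carries \<open>p N\<close> to \<open>M\<close> and \<open>N\<close> to \<open>q M\<close>.
  Thus \<open>(q(x), 1)\<close> is the integral of \<open>(1, p(y))\<close> against \<open>s(y,x) N(dy)\<close>; writing \<open>s\<close> as \<open>\<delta> m\<close> plus a
  remainder, the first part contributes \<open>\<delta> m(x) (1, 1)\<close>, where \<open>\<Phi>\<close> vanishes, and the remainder, of mass
  \<open>1 - \<delta>\<close>, is handled by Jensen's inequality. Only half of the minorizing mass is split off, so that the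
  remainder is strictly positive and can be normalized.

  If \<open>\<Phi> 1\<close> is finite on both sides of \<open>1\<close>, subtracting a support line at \<open>1\<close> makes it nonnegative without
  changing either entropy, because \<open>p\<close> and \<open>q\<close> have mean one. Otherwise finiteness of the entropy of \<open>p\<close>
  forces \<open>p\<close> to one side of its mean, and then \<open>p\<close> and \<open>q\<close> are constant.
\<close>
lemma entropy_contraction_step:
  fixes M :: "'a measure" and N :: "'b measure" and s :: "'b \<Rightarrow> 'a \<Rightarrow> real"
  assumes \<Phi>: "entropy_function \<Phi>" and M: "prob_space M" and N: "prob_space N"
    and s[measurable]: "(\<lambda>(y, x). s y x) \<in> borel_measurable (N \<Otimes>\<^sub>M M)"
    and \<delta>: "0 < \<delta>" "\<delta> < 1"
    and m[measurable]: "m \<in> borel_measurable M" "\<And>x. 0 < m x" "(\<integral>\<^sup>+x. ennreal (m x) \<partial>M) = 1"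
    and minor: "\<And>x y. x \<in> space M \<Longrightarrow> y \<in> space N \<Longrightarrow> 2 * \<delta> * m x \<le> s y x"
    and s1: "\<And>y. y \<in> space N \<Longrightarrow> (\<integral>\<^sup>+x. ennreal (s y x) \<partial>M) = 1"
    and p[measurable]: "p \<in> borel_measurable N" "\<And>y. 0 < p y" "(\<integral>\<^sup>+y. ennreal (p y) \<partial>N) = 1"
    and sp: "\<And>x. x \<in> space M \<Longrightarrow> (\<integral>\<^sup>+y. ennreal (s y x * p y) \<partial>N) = 1"
    and q[measurable]: "q \<in> borel_measurable M" "\<And>x. 0 < q x"
    and sq: "\<And>x. x \<in> space M \<Longrightarrow> (\<integral>\<^sup>+y. ennreal (s y x) \<partial>N) = ennreal (q x)"
  shows "ereal_integral M (\<lambda>x. \<Phi> (q x) 1) \<le> ereal (1 - \<delta>) * ereal_integral N (\<lambda>y. \<Phi> 1 (p y))"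
proof -
  interpret M: prob_space M by fact
  interpret N: prob_space N by fact
  interpret NM: pair_sigma_finite N M ..
  note conv = ext_convex_entropy_function[OF \<Phi>]
  note one = entropy_function_1_1[OF \<Phi>]
  have s_pos: "0 < s y x" if "x \<in> space M" "y \<in> space N" for x y
    using minor[OF that] \<delta> m(2)[of x] by (meson less_le_trans mult_pos_pos zero_less_numeral)
  have [measurable]: "(\<lambda>y. s y x) \<in> borel_measurable N" if "x \<in> space M" for x
    using measurable_compose[OF measurable_Pair2'[OF that] s] by simp
  have q_eq: "\<Phi> (q x) 1 = ereal (q x) * \<Phi> 1 (1 / q x)" for x
    using entropy_function_eq[OF \<Phi>, of "q x" 1] q(2) by simp
  have int_s: "has_bochner_integral N (\<lambda>y. s y x) (q x)" if "x \<in> space M" for x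
    using that sq[OF that] s_pos[OF that] q(2)[of x]
    by (intro has_bochner_integral_nn_integral) (auto intro!: AE_I2 less_imp_le)
  have int_sp: "has_bochner_integral N (\<lambda>y. s y x * p y) 1" if "x \<in> space M" for x
    using that sp[OF that] s_pos[OF that] p(2)
    by (intro has_bochner_integral_nn_integral) (auto intro!: AE_I2 less_imp_le mult_pos_pos)
  have int_p: "has_bochner_integral N p 1"
    using p by (intro has_bochner_integral_nn_integral) (auto intro!: AE_I2 less_imp_le)
  show ?thesis
  proof (cases "\<exists>s0 t0. 0 < s0 \<and> s0 < 1 \<and> 1 < t0 \<and> \<Phi> 1 s0 \<noteq> \<infinity> \<and> \<Phi> 1 t0 \<noteq> \<infinity>")
    case True
    then obtain s0 t0 where st: "0 < s0" "s0 < 1" "1 < t0" "\<Phi> 1 s0 \<noteq> \<infinity>" "\<Phi> 1 t0 \<noteq> \<infinity>" by auto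
    obtain c where c: "\<And>t. 0 < t \<Longrightarrow> ereal (c * (t - 1)) \<le> \<Phi> 1 t"
      using ext_convex_support_line[OF conv st] one by (metis add_0 ereal_eq_0(2))
    define \<psi> where "\<psi> t = \<Phi> 1 t - ereal (c * (t - 1))" for t
    have \<psi>_nn: "0 \<le> \<psi> t" if "0 < t" for t
      using c[OF that] by (cases "\<Phi> 1 t") (auto simp: \<psi>_def)
    have \<psi>_1: "\<psi> 1 = 0" by (simp add: \<psi>_def one)
    have \<Phi>_\<psi>: "\<Phi> 1 t = ereal (c * (t - 1)) + \<psi> t" for t
      by (cases "\<Phi> 1 t") (auto simp: \<psi>_def)
    have conv_\<psi>: "ext_convex \<psi>"
      unfolding ext_convex_def
    proof (intro conjI allI impI ballI)
      fix s t l :: real assume stl: "0 < s" "0 < t" "l \<in> {0..1}"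
      have "\<Phi> 1 s \<noteq> -\<infinity>" "\<Phi> 1 t \<noteq> -\<infinity>"
        using conv stl unfolding ext_convex_def by auto
      then have "ereal (1 - l) * \<Phi> 1 s + ereal l * \<Phi> 1 t - ereal (c * ((1 - l) * s + l * t - 1))
          = ereal (1 - l) * \<psi> s + ereal l * \<psi> t"
        using stl by (cases "\<Phi> 1 s"; cases "\<Phi> 1 t"; cases "l = 0"; cases "l = 1")
          (auto simp: \<psi>_def algebra_simps)
      moreover have "\<psi> ((1 - l) * s + l * t)
          \<le> ereal (1 - l) * \<Phi> 1 s + ereal l * \<Phi> 1 t - ereal (c * ((1 - l) * s + l * t - 1))"
        unfolding \<psi>_def using ext_convexD[OF conv, of s t l] stl by (intro ereal_minus_mono) auto
      ultimately show "\<psi> ((1 - l) * s + l * t) \<le> ereal (1 - l) * \<psi> s + ereal l * \<psi> t" by simp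
    qed (use \<psi>_nn in \<open>auto dest!: \<psi>_nn\<close>)
    have [measurable]: "(\<lambda>y. \<psi> (p y)) \<in> borel_measurable N" "(\<lambda>x. \<psi> (1 / q x)) \<in> borel_measurable M"
      using p(2) q(2) by (intro borel_measurable_ext_convex[OF conv_\<psi>]; simp)+

    have pointwise: "ennreal (q x) * e2ennreal (\<psi> (1 / q x))
        \<le> (\<integral>\<^sup>+y. ennreal (s y x - \<delta> * m x) * e2ennreal (\<psi> (p y)) \<partial>N)" if x: "x \<in> space M" for x
    proof -
      define d where "d = \<delta> * m x"
      have d: "0 < d" using \<delta> m(2) by (simp add: d_def)
      have minor_d: "2 * d \<le> s y x" if "y \<in> space N" for y
        using minor[OF x that] by (simp add: d_def mult.assoc)
      have sd: "d < s y x" if "y \<in> space N" for y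
        using minor_d[OF that] d by simp
      have "2 * d \<le> q x"
      proof -
        have "(\<integral>y. 2 * d \<partial>N) \<le> (\<integral>y. s y x \<partial>N)"
          using int_s[OF x] minor_d by (intro integral_mono) (auto simp: has_bochner_integral_iff)
        then show ?thesis using int_s[OF x] by (simp add: has_bochner_integral_iff N.prob_space)
      qed
      have "2 * d \<le> 1"
      proof -
        have "(\<integral>y. 2 * d * p y \<partial>N) \<le> (\<integral>y. s y x * p y \<partial>N)"
          using int_sp[OF x] int_p minor_d p(2)
          by (intro integral_mono mult_right_mono) (auto simp: has_bochner_integral_iff less_imp_le)
        then show ?thesis using int_sp[OF x] int_p by (simp add: has_bochner_integral_iff)
      qed
      \<comment> \<open>\<open>b\<close> is the mass and \<open>1 - d\<close> the first moment of the remainder \<open>\<theta>\<close>, so \<open>z\<close> is the mean of \<open>p\<close>; then \<open>1 / q x\<close> is the mixture of \<open>z\<close> and \<open>1\<close> with weights \<open>b / q x\<close> and \<open>d / q x\<close>.\<close>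
      define b where "b = q x - d"
      define z where "z = (1 - d) / b"
      have b: "0 < b" using \<open>2 * d \<le> q x\<close> d by (simp add: b_def)
      have z: "0 < z" using b \<open>2 * d \<le> 1\<close> d by (simp add: z_def)
      define \<theta> where "\<theta> = density N (\<lambda>y. ennreal (s y x - d))"
      have sd_nn: "AE y in N. 0 \<le> s y x - d" using sd by (auto intro!: AE_I2 less_imp_le)
      have [measurable]: "(\<lambda>y. s y x) \<in> borel_measurable N" using x by measurable
      have "has_bochner_integral N (\<lambda>y. s y x - d) b"
        unfolding b_def
        using has_bochner_integral_diff[OF int_s[OF x] N.has_bochner_integral_const[of d]] by simp
      then have "(\<integral>\<^sup>+y. ennreal (s y x - d) \<partial>N) = ennreal b"
        using sd_nn by (subst nn_integral_eq_integral) (auto simp: has_bochner_integral_iff)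
      then have mass: "emeasure \<theta> (space \<theta>) = ennreal b"
        by (simp add: \<theta>_def emeasure_density cong: nn_integral_cong)
      then have mass': "measure \<theta> (space \<theta>) = b" using b by (simp add: measure_def)
      have "has_bochner_integral N (\<lambda>y. s y x * p y - d * p y) (1 - d * 1)"
        by (intro has_bochner_integral_diff int_sp[OF x] has_bochner_integral_mult_right int_p)
      then have int_\<theta>: "has_bochner_integral N (\<lambda>y. (s y x - d) * p y) (1 - d)"
        by (simp add: algebra_simps)
      have "ennreal b * e2ennreal (\<psi> z) \<le> (\<integral>\<^sup>+y. e2ennreal (\<psi> (p y)) \<partial>\<theta>)"
        unfolding mass'[symmetric]
      proof (rule jensen_ext_convex[OF conv_\<psi> \<psi>_nn])
        show "finite_measure \<theta>" using mass by (intro finite_measureI) auto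
        show "integrable \<theta> p" unfolding \<theta>_def
          using int_\<theta> sd_nn by (subst integrable_density) (auto simp: has_bochner_integral_iff)
        have "integral\<^sup>L \<theta> p = 1 - d" unfolding \<theta>_def
          using int_\<theta> sd_nn by (subst integral_density) (auto simp: has_bochner_integral_iff)
        then show "z = integral\<^sup>L \<theta> p / measure \<theta> (space \<theta>)" by (simp add: mass' z_def)
      qed (use p(2) b mass' in \<open>auto simp: \<theta>_def\<close>)
      also have "\<dots> = (\<integral>\<^sup>+y. ennreal (s y x - d) * e2ennreal (\<psi> (p y)) \<partial>N)"
        unfolding \<theta>_def by (subst nn_integral_density) auto
      finally have J: "ennreal b * e2ennreal (\<psi> z) \<le> \<dots>" .
      have "\<psi> (1 / q x) \<le> ereal (b / q x) * \<psi> z"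
      proof -
        have "(1 - d / q x) * z + d / q x * 1 = 1 / q x"
          using b q(2)[of x] unfolding z_def b_def by (simp add: field_simps)
        moreover have "1 - d / q x = b / q x" using q(2)[of x] by (simp add: b_def field_simps)
        ultimately show ?thesis
          using ext_convexD[OF conv_\<psi> z, of 1 "d / q x"] d b q(2)[of x]
          by (simp add: \<psi>_1 b_def)
      qed
      then have "ennreal (q x) * e2ennreal (\<psi> (1 / q x)) \<le> ennreal (q x) * (ennreal (b / q x) * e2ennreal (\<psi> z))"
        using e2ennreal_mono[of "\<psi> (1 / q x)" "ereal (b / q x) * \<psi> z"] b q(2)[of x]
        by (intro mult_left_mono) (auto simp: e2ennreal_ereal_mult)
      also have "\<dots> = ennreal b * e2ennreal (\<psi> z)"
        using b q(2)[of x] by (simp add: mult.assoc[symmetric] ennreal_mult[symmetric])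
      finally show ?thesis using J unfolding d_def by simp
    qed

    have "(\<integral>\<^sup>+x. ennreal (q x) \<partial>M) = (\<integral>\<^sup>+x. \<integral>\<^sup>+y. ennreal (s y x) \<partial>N \<partial>M)"
      by (intro nn_integral_cong) (simp add: sq)
    also have "\<dots> = (\<integral>\<^sup>+y. \<integral>\<^sup>+x. ennreal (s y x) \<partial>M \<partial>N)"
      by (rule NM.Fubini') measurable
    also have "\<dots> = 1" by (simp add: s1 N.emeasure_space_1 cong: nn_integral_cong)
    finally have int_q: "has_bochner_integral M q 1"
      using q by (intro has_bochner_integral_nn_integral) (auto intro!: AE_I2 less_imp_le)

    have N_eq: "ereal_integral N (\<lambda>y. \<Phi> 1 (p y)) = enn2ereal (\<integral>\<^sup>+y. e2ennreal (\<psi> (p y)) \<partial>N)"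
    proof -
      have h: "has_bochner_integral N (\<lambda>y. c * (p y - 1)) (c * (1 - 1))"
        using has_bochner_integral_diff[OF int_p N.has_bochner_integral_const[of 1]]
        by (intro has_bochner_integral_mult_right) auto
      then show ?thesis
        using \<psi>_nn[OF p(2)]
        by (subst ereal_integral_eq_integral_plus_nn_integral[where h="\<lambda>y. c * (p y - 1)" and G="\<lambda>y. e2ennreal (\<psi> (p y))"])
           (auto simp: has_bochner_integral_iff \<Phi>_\<psi> enn2ereal_e2ennreal)
    qed
    have M_eq: "ereal_integral M (\<lambda>x. \<Phi> (q x) 1) = enn2ereal (\<integral>\<^sup>+x. ennreal (q x) * e2ennreal (\<psi> (1 / q x)) \<partial>M)"
    proof -
      have h: "has_bochner_integral M (\<lambda>x. c * (1 - q x)) (c * (1 - 1))"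
        using has_bochner_integral_diff[OF M.has_bochner_integral_const[of 1] int_q]
        by (intro has_bochner_integral_mult_right) auto
      have eq: "\<Phi> (q x) 1 = ereal (c * (1 - q x)) + enn2ereal (ennreal (q x) * e2ennreal (\<psi> (1 / q x)))" for x
      proof -
        have "enn2ereal (ennreal (q x) * e2ennreal (\<psi> (1 / q x))) = ereal (q x) * \<psi> (1 / q x)"
          using q(2)[of x] \<psi>_nn[of "1 / q x"]
          by (subst e2ennreal_ereal_mult[symmetric]) (auto intro!: enn2ereal_e2ennreal simp: less_imp_le)
        moreover have "\<Phi> (q x) 1 = ereal (c * (1 - q x)) + ereal (q x) * \<psi> (1 / q x)"
          unfolding q_eq using q(2)[of x] by (subst \<Phi>_\<psi>, cases "\<psi> (1 / q x)") (auto simp: field_simps)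
        ultimately show ?thesis by simp
      qed
      show ?thesis
        using h by (subst ereal_integral_eq_integral_plus_nn_integral[OF _ _ eq]) (auto simp: has_bochner_integral_iff)
    qed
    have "(\<integral>\<^sup>+x. ennreal (q x) * e2ennreal (\<psi> (1 / q x)) \<partial>M)
        \<le> (\<integral>\<^sup>+x. \<integral>\<^sup>+y. ennreal (s y x - \<delta> * m x) * e2ennreal (\<psi> (p y)) \<partial>N \<partial>M)"
      by (intro nn_integral_mono pointwise)
    also have "\<dots> = (\<integral>\<^sup>+y. \<integral>\<^sup>+x. ennreal (s y x - \<delta> * m x) * e2ennreal (\<psi> (p y)) \<partial>M \<partial>N)"
      by (rule NM.Fubini') measurable
    also have "\<dots> = (\<integral>\<^sup>+y. ennreal (1 - \<delta>) * e2ennreal (\<psi> (p y)) \<partial>N)"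
    proof (intro nn_integral_cong)
      fix y assume y: "y \<in> space N"
      have [measurable]: "(\<lambda>x. s y x) \<in> borel_measurable M"
        using measurable_compose[OF measurable_Pair1'[OF y] s] by simp
      have "has_bochner_integral M (\<lambda>x. s y x) 1"
        using s1[OF y] s_pos[OF _ y]
        by (intro has_bochner_integral_nn_integral) (auto intro!: AE_I2 less_imp_le)
      moreover have "has_bochner_integral M m 1"
        using m by (intro has_bochner_integral_nn_integral) (auto intro!: AE_I2 less_imp_le)
      ultimately have "has_bochner_integral M (\<lambda>x. s y x - \<delta> * m x) (1 - \<delta> * 1)"
        by (intro has_bochner_integral_diff has_bochner_integral_mult_right)
      moreover have "AE x in M. 0 \<le> s y x - \<delta> * m x"
      proof (rule AE_I2)
        fix x assume x: "x \<in> space M"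
        have "0 < \<delta> * m x" using \<delta> m(2) by simp
        then show "0 \<le> s y x - \<delta> * m x" using minor[OF x y] by simp
      qed
      ultimately have "(\<integral>\<^sup>+x. ennreal (s y x - \<delta> * m x) \<partial>M) = ennreal (1 - \<delta>)"
        by (subst nn_integral_eq_integral) (auto simp: has_bochner_integral_iff)
      then show "(\<integral>\<^sup>+x. ennreal (s y x - \<delta> * m x) * e2ennreal (\<psi> (p y)) \<partial>M) = ennreal (1 - \<delta>) * e2ennreal (\<psi> (p y))"
        by (subst nn_integral_multc) auto
    qed
    also have "\<dots> = ennreal (1 - \<delta>) * (\<integral>\<^sup>+y. e2ennreal (\<psi> (p y)) \<partial>N)"
      by (rule nn_integral_cmult) measurable
    finally show ?thesis
      unfolding M_eq N_eq using \<delta> by (simp add: less_eq_ennreal.rep_eq times_ennreal.rep_eq enn2ereal_ennreal)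
  next
    case no_line: False
    have [measurable]: "(\<lambda>y. \<Phi> 1 (p y)) \<in> borel_measurable N"
      using p by (intro borel_measurable_ext_convex[OF conv]) auto
    show ?thesis
    proof (cases "ereal_integral N (\<lambda>y. \<Phi> 1 (p y)) = \<infinity>")
      case False
      then have "(\<integral>\<^sup>+y. e2ennreal (\<Phi> 1 (p y)) \<partial>N) \<noteq> \<infinity>"
        by (auto simp: ereal_integral_def)
      then have finite_AE: "AE y in N. \<Phi> 1 (p y) \<noteq> \<infinity>"
        using nn_integral_PInf_AE[of "\<lambda>y. e2ennreal (\<Phi> 1 (p y))" N] by (auto elim!: eventually_mono)
      have side: "(AE y in N. 0 \<le> p y - 1) \<or> (AE y in N. 0 \<le> 1 - p y)"
      proof (cases "\<exists>s0. 0 < s0 \<and> s0 < 1 \<and> \<Phi> 1 s0 \<noteq> \<infinity>")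
        case True
        then have "AE y in N. 0 \<le> 1 - p y"
          using finite_AE no_line by (auto elim!: eventually_mono simp: not_less[symmetric])
        then show ?thesis ..
      next
        case False
        then have "AE y in N. 0 \<le> p y - 1"
          using finite_AE p(2) by (auto elim!: eventually_mono simp: not_less[symmetric])
        then show ?thesis ..
      qed
      have "AE y in N. p y = 1"
        using side
      proof
        assume "AE y in N. 0 \<le> p y - 1"
        moreover have "has_bochner_integral N (\<lambda>y. p y - 1) (1 - 1)"
          using has_bochner_integral_diff[OF int_p N.has_bochner_integral_const[of 1]] by simp
        ultimately have "AE y in N. p y - 1 = 0"
          by (subst integral_nonneg_eq_0_iff_AE[symmetric]) (auto simp: has_bochner_integral_iff)
        then show ?thesis by auto
      next
        assume "AE y in N. 0 \<le> 1 - p y"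
        moreover have "has_bochner_integral N (\<lambda>y. 1 - p y) (1 - 1)"
          using has_bochner_integral_diff[OF N.has_bochner_integral_const[of 1] int_p] by simp
        ultimately have "AE y in N. 1 - p y = 0"
          by (subst integral_nonneg_eq_0_iff_AE[symmetric]) (auto simp: has_bochner_integral_iff)
        then show ?thesis by auto
      qed
      note p1 = this
      have "\<Phi> (q x) 1 = 0" if x: "x \<in> space M" for x
      proof -
        have "(\<integral>\<^sup>+y. ennreal (s y x) \<partial>N) = (\<integral>\<^sup>+y. ennreal (s y x * p y) \<partial>N)"
          using p1 by (intro nn_integral_cong_AE) auto
        then have "q x = 1" using sp[OF x] sq[OF x] by simp
        then show ?thesis using one by simp
      qed
      then have "ereal_integral M (\<lambda>x. \<Phi> (q x) 1) = 0"
        by (simp add: ereal_integral_def cong: nn_integral_cong)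
      moreover have "ereal_integral N (\<lambda>y. \<Phi> 1 (p y)) = 0"
      proof -
        have "(\<integral>\<^sup>+y. e2ennreal (\<Phi> 1 (p y)) \<partial>N) = (\<integral>\<^sup>+y. 0 \<partial>N)"
          "(\<integral>\<^sup>+y. e2ennreal (- \<Phi> 1 (p y)) \<partial>N) = (\<integral>\<^sup>+y. 0 \<partial>N)"
          using p1 one by (intro nn_integral_cong_AE; auto elim!: eventually_mono)+
        then show ?thesis by (simp add: ereal_integral_def)
      qed
      ultimately show ?thesis by simp
    qed (use \<delta> in simp)
  qed
qed

section \<open>Entropies and logarithmic norms of measures given by a density\<close>

lemma dominating_commute: "dominating \<mu>1 \<mu>2 = dominating \<mu>2 \<mu>1"
  by (auto simp: dominating_def fun_eq_iff)

lemma Phi_entropy_swap: "Phi_entropy \<Phi> \<mu>1 \<mu>2 = Phi_entropy (\<lambda>u v. \<Phi> v u) \<mu>2 \<mu>1"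
  by (simp add: Phi_entropy_def dominating_commute[of \<mu>1])

text \<open>
  For any dominating \<open>\<gamma>\<close> with \<open>r = dN/d\<gamma>\<close>, the two densities are \<open>p r\<close> and \<open>r\<close>; homogeneity of \<open>\<Phi>\<close>
  pulls out \<open>r\<close>, which turns the integral over \<open>\<gamma>\<close> into one over \<open>N\<close>.
\<close>
lemma Phi_entropy_density:
  assumes \<Phi>: "entropy_function \<Phi>" and N: "sigma_finite_measure N"
    and p[measurable]: "p \<in> borel_measurable N" and pos: "\<And>x. 0 < p x"
  shows "Phi_entropy \<Phi> (density N (\<lambda>x. ennreal (p x))) N = ereal_integral N (\<lambda>x. \<Phi> (p x) 1)"
proof -
  define \<gamma> where "\<gamma> = (SOME \<gamma>. dominating (density N (\<lambda>x. ennreal (p x))) N \<gamma>)"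
  have "dominating (density N (\<lambda>x. ennreal (p x))) N N"
    using N by (auto simp: dominating_def intro!: absolutely_continuousI_density)
       (auto simp: absolutely_continuous_def)
  then have dom: "dominating (density N (\<lambda>x. ennreal (p x))) N \<gamma>"
    unfolding \<gamma>_def by (rule someI)
  then interpret sigma_finite_measure \<gamma> by (simp add: dominating_def)
  have ac: "absolutely_continuous \<gamma> N" and sets[measurable_cong]: "sets \<gamma> = sets N"
    using dom by (auto simp: dominating_def)
  have space: "space \<gamma> = space N" by (rule sets_eq_imp_space_eq[OF sets])
  define r where "r = RN_deriv \<gamma> N"
  have [measurable]: "r \<in> borel_measurable \<gamma>" by (simp add: r_def)
  have N_eq: "density \<gamma> r = N"
    unfolding r_def using ac sets by (intro density_RN_deriv) simp_all
  have r_fin: "AE x in \<gamma>. r x \<noteq> \<infinity>"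
    unfolding r_def using N ac sets by (intro RN_deriv_finite) auto
  have [measurable]: "p \<in> borel_measurable \<gamma>" by measurable
  have "density \<gamma> (\<lambda>x. r x * ennreal (p x)) = density N (\<lambda>x. ennreal (p x))"
    by (subst N_eq[symmetric], subst density_density_eq) auto
  then have RN: "AE x in \<gamma>. r x * ennreal (p x) = RN_deriv \<gamma> (density N (\<lambda>x. ennreal (p x))) x"
    by (intro RN_deriv_unique) auto
  have conv: "ext_convex (\<lambda>t. \<Phi> t 1)"
    using ext_convex_entropy_function[OF entropy_function_swap[OF \<Phi>]] by simp
  have [measurable]: "(\<lambda>x. \<Phi> (p x) 1) \<in> borel_measurable \<gamma>"
    using pos by (intro borel_measurable_ext_convex[OF conv]) auto
  have F: "AE x in \<gamma>. \<Phi> (enn2real (RN_deriv \<gamma> (density N (\<lambda>x. ennreal (p x))) x)) (enn2real (RN_deriv \<gamma> N x))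
      = ereal (enn2real (r x)) * \<Phi> (p x) 1"
    using RN
  proof eventually_elim
    case (elim x)
    then have "RN_deriv \<gamma> (density N (\<lambda>x. ennreal (p x))) x = r x * ennreal (p x)" by simp
    then show ?case
      using entropy_function_homogeneous[OF \<Phi>, of "enn2real (r x)" "p x" 1] pos[of x]
      by (simp add: r_def enn2real_mult)
  qed
  have change: "(\<integral>\<^sup>+x. e2ennreal (G x) \<partial>\<gamma>) = (\<integral>\<^sup>+x. e2ennreal (H x) \<partial>N)"
    if "AE x in \<gamma>. G x = ereal (enn2real (r x)) * H x" and [measurable]: "H \<in> borel_measurable \<gamma>"
    for G H
  proof -
    have "(\<integral>\<^sup>+x. e2ennreal (G x) \<partial>\<gamma>) = (\<integral>\<^sup>+x. r x * e2ennreal (H x) \<partial>\<gamma>)"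
      using that(1) r_fin
      by (intro nn_integral_cong_AE, eventually_elim) (auto simp: e2ennreal_ereal_mult less_top)
    also have "\<dots> = (\<integral>\<^sup>+x. e2ennreal (H x) \<partial>N)"
      by (subst N_eq[symmetric], subst nn_integral_density) auto
    finally show ?thesis .
  qed
  show ?thesis
    unfolding Phi_entropy_def Let_def \<gamma>_def[symmetric] ereal_integral_def
    using F by (subst change[OF F] change[of _ "\<lambda>x. - \<Phi> (p x) 1"]; (measurable | auto elim: eventually_mono))+
qed

lemma log_deriv_norm_density_le:
  assumes M: "sigma_finite_measure M" and p[measurable]: "p \<in> borel_measurable M"
    and pos: "\<And>x. 0 < p x" and bound: "\<And>x. \<bar>ln (p x)\<bar> \<le> b"
  shows "log_deriv_norm (density M (\<lambda>x. ennreal (p x))) M \<le> ereal b"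
proof -
  interpret sigma_finite_measure M by fact
  have ac: "absolutely_continuous M (density M (\<lambda>x. ennreal (p x)))"
    by (rule absolutely_continuousI_density) simp
  have "AE x in M. ennreal (p x) = RN_deriv M (density M (\<lambda>x. ennreal (p x))) x"
    by (intro RN_deriv_unique) auto
  then have AE: "AE x in M. \<bar>log_ennreal (RN_deriv M (density M (\<lambda>x. ennreal (p x))) x)\<bar> \<le> ereal b"
  proof eventually_elim
    case (elim x)
    show ?case
      using bound[of x] pos[of x] unfolding elim[symmetric] log_ennreal_def
      by (simp add: ennreal_eq_0_iff not_le)
  qed
  have [measurable]: "log_ennreal \<in> borel_measurable borel"
    unfolding log_ennreal_def[abs_def] by measurable
  show ?thesis
    unfolding log_deriv_norm_def if_P[OF ac] using AE by (intro esssup_I) auto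
qed

lemma log_deriv_norm_density_le':
  assumes "prob_space (density M (\<lambda>x. ennreal (p x)))" and p[measurable]: "p \<in> borel_measurable M"
    and pos: "\<And>x. 0 < p x" and bound: "\<And>x. \<bar>ln (p x)\<bar> \<le> b"
  shows "log_deriv_norm M (density M (\<lambda>x. ennreal (p x))) \<le> ereal b"
proof -
  have p0: "p x \<noteq> 0" for x using pos[of x] by simp
  interpret prob_space "density M (\<lambda>x. ennreal (p x))" by fact
  have "density (density M (\<lambda>x. ennreal (p x))) (\<lambda>x. ennreal (1 / p x)) = density M (\<lambda>x. 1)"
    using pos
    by (subst density_density_eq) (auto intro!: density_cong AE_I2 simp: ennreal_mult[symmetric] less_imp_le p0)
  then have "M = density (density M (\<lambda>x. ennreal (p x))) (\<lambda>x. ennreal (1 / p x))"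
    by (simp add: density_1)
  then have "log_deriv_norm M (density M (\<lambda>x. ennreal (p x))) = log_deriv_norm
      (density (density M (\<lambda>x. ennreal (p x))) (\<lambda>x. ennreal (1 / p x))) (density M (\<lambda>x. ennreal (p x)))"
    by simp
  also have "\<dots> \<le> ereal b"
    using pos bound p0 by (intro log_deriv_norm_density_le) (auto simp: sigma_finite_measure_axioms ln_div)
  finally show ?thesis .
qed

section \<open>The half-step for a kernel bounded above and below\<close>

definition weight :: "'a measure \<Rightarrow> ('a \<Rightarrow> real) \<Rightarrow> bool" where
  "weight M f \<longleftrightarrow> integrable M f \<and> (\<forall>x. 0 < f x)"

text \<open>
  The Sinkhorn half-step on exponentials of potentials: \<open>f = scaling k N g\<close> is the function for which
  \<open>k(x,y) f(x) g(y) N(dy)\<close> is a Markov kernel.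
\<close>
definition scaling :: "('a \<Rightarrow> 'b \<Rightarrow> real) \<Rightarrow> 'b measure \<Rightarrow> ('b \<Rightarrow> real) \<Rightarrow> 'a \<Rightarrow> real" where
  "scaling k N g x = 1 / (\<integral>y. k x y * g y \<partial>N)"

lemma abs_ln_diff_le_iff:
  fixes u v e :: real
  assumes "0 < u" "0 < v"
  shows "\<bar>ln u - ln v\<bar> \<le> e \<longleftrightarrow> exp (- e) * v \<le> u \<and> u \<le> exp e * v"
proof -
  have "exp (- e) * v \<le> u \<longleftrightarrow> - e + ln v \<le> ln u"
    using assms by (metis exp_add exp_ln exp_le_cancel_iff)
  moreover have "u \<le> exp e * v \<longleftrightarrow> ln u \<le> e + ln v"
    using assms by (metis exp_add exp_ln exp_le_cancel_iff)
  ultimately show ?thesis by auto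
qed

text \<open>
  The measures play symmetric roles, and exchanging them turns one half-step into the opposite one.
  The two bounds are inverse to each other only to keep this symmetric setting to one parameter. The
  spaces are whole types, so that the iterates are positive and bounded at every point and the
  estimates of their logarithms hold everywhere.
\<close>
locale bounded_kernel = M: prob_space M + N: prob_space N
  for M :: "'a measure" and N :: "'b measure" and k :: "'a \<Rightarrow> 'b \<Rightarrow> real" and a :: real +
  assumes k_measurable[measurable]: "(\<lambda>(x, y). k x y) \<in> borel_measurable (M \<Otimes>\<^sub>M N)"
    and a: "0 < a" "a < 1"
    and k_bounds: "a \<le> k x y" "k x y \<le> 1 / a"
    and space_M: "space M = UNIV" and space_N: "space N = UNIV"
begin

lemma swap: "bounded_kernel N M (\<lambda>y x. k x y) a"
proof -
  have "(\<lambda>(y, x). k x y) \<in> borel_measurable (N \<Otimes>\<^sub>M M)"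
    using measurable_pair_swap[OF k_measurable] by (simp add: case_prod_unfold)
  then show ?thesis
    using a k_bounds space_M space_N by unfold_locales auto
qed

lemma k_pos: "0 < k x y"
  using a k_bounds(1)[of x y] by simp

lemma k_section[measurable]: "(\<lambda>y. k x y) \<in> borel_measurable N"
  using measurable_compose[OF measurable_Pair1'[of x M N] k_measurable] by (simp add: space_M)

context
  fixes g assumes g: "weight N g"
begin

lemma weight_measurable[measurable]: "g \<in> borel_measurable N"
  using g by (auto simp: weight_def)

lemma weight_pos: "0 < g y" and weight_integrable: "integrable N g"
  using g by (auto simp: weight_def)

lemma integrable_kernel: "integrable N (\<lambda>y. k x y * g y)"
proof (rule Bochner_Integration.integrable_bound)
  show "integrable N (\<lambda>y. 1 / a * g y)" using weight_integrable by simp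
  show "AE y in N. norm (k x y * g y) \<le> norm (1 / a * g y)"
    using k_bounds(2) k_pos weight_pos a
    by (auto intro!: AE_I2 mult_right_mono simp: abs_mult less_imp_le simp del: times_divide_eq_left)
qed measurable

lemma weight_integral_pos: "0 < (\<integral>y. g y \<partial>N)"
proof -
  have "(\<integral>y. g y \<partial>N) \<noteq> 0"
    using weight_pos integral_nonneg_eq_0_iff_AE[OF weight_integrable] N.AE_False
    by (auto simp: less_imp_le less_imp_neq[symmetric])
  moreover have "0 \<le> (\<integral>y. g y \<partial>N)" using weight_pos by (intro integral_nonneg_AE) (auto simp: less_imp_le)
  ultimately show ?thesis by simp
qed

lemma kernel_integral_ge: "a * (\<integral>y. g y \<partial>N) \<le> (\<integral>y. k x y * g y \<partial>N)"
  using integral_mono[of N "\<lambda>y. a * g y" "\<lambda>y. k x y * g y"] weight_integrable integrable_kernel k_bounds(1) weight_pos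
  by (auto simp: less_imp_le mult_right_mono)

lemma kernel_integral_le: "(\<integral>y. k x y * g y \<partial>N) \<le> 1 / a * (\<integral>y. g y \<partial>N)"
  using integral_mono[of N "\<lambda>y. k x y * g y" "\<lambda>y. 1 / a * g y"] weight_integrable integrable_kernel k_bounds(2) weight_pos
  by (auto simp: less_imp_le mult_right_mono simp del: times_divide_eq_left)

lemma kernel_integral_pos: "0 < (\<integral>y. k x y * g y \<partial>N)"
  using kernel_integral_ge weight_integral_pos a by (meson less_le_trans mult_pos_pos)

lemma scaling_pos: "0 < scaling k N g x"
  using kernel_integral_pos by (simp add: scaling_def)

lemma scaling_measurable[measurable]: "scaling k N g \<in> borel_measurable M"
  unfolding scaling_def[abs_def] by measurable

lemma scaling_ge: "a / (\<integral>y. g y \<partial>N) \<le> scaling k N g x"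
  and scaling_le: "scaling k N g x \<le> 1 / (a * (\<integral>y. g y \<partial>N))"
  using kernel_integral_ge[of x] kernel_integral_le[of x] kernel_integral_pos[of x] weight_integral_pos a
  by (auto simp: scaling_def field_simps)

lemma weight_scaling: "weight M (scaling k N g)"
proof -
  have "integrable M (scaling k N g)"
    using scaling_le scaling_pos
    by (intro M.integrable_const_bound[where B="1 / (a * (\<integral>y. g y \<partial>N))"]) (auto intro!: AE_I2 simp: less_imp_le)
  then show ?thesis using scaling_pos by (simp add: weight_def)
qed

lemma nn_integral_kernel_weight: "(\<integral>\<^sup>+y. ennreal (k x y * g y) \<partial>N) = ennreal (1 / scaling k N g x)"
  using integrable_kernel k_pos weight_pos
  by (subst nn_integral_eq_integral) (auto intro!: AE_I2 simp: scaling_def less_imp_le)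

text \<open>
  By Tonelli's theorem both sides are the total mass of \<open>k(x,y) f(x) g(y)\<close> with \<open>f = scaling k N g\<close>.
\<close>
lemma nn_integral_ratio_scaling_scaling:
  "(\<integral>\<^sup>+y. ennreal (g y / scaling (\<lambda>y x. k x y) M (scaling k N g) y) \<partial>N) = 1"
proof -
  interpret op: bounded_kernel N M "\<lambda>y x. k x y" a by (rule swap)
  interpret MN: pair_sigma_finite M N ..
  define f where "f = scaling k N g"
  have f: "weight M f" unfolding f_def by (rule weight_scaling)
  note [measurable] = op.weight_measurable[OF f]
  have "(\<integral>\<^sup>+y. ennreal (g y / scaling (\<lambda>y x. k x y) M f y) \<partial>N)
      = (\<integral>\<^sup>+y. ennreal (g y) * (\<integral>\<^sup>+x. ennreal (k x y * f x) \<partial>M) \<partial>N)"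
    using weight_pos op.scaling_pos[OF f]
    by (intro nn_integral_cong) (simp add: op.nn_integral_kernel_weight[OF f] ennreal_mult[symmetric] less_imp_le)
  also have "\<dots> = (\<integral>\<^sup>+y. (\<integral>\<^sup>+x. ennreal (g y) * ennreal (k x y * f x) \<partial>M) \<partial>N)"
    by (simp add: nn_integral_cmult)
  also have "\<dots> = (\<integral>\<^sup>+x. (\<integral>\<^sup>+y. ennreal (g y) * ennreal (k x y * f x) \<partial>N) \<partial>M)"
    by (rule MN.Fubini') measurable
  also have "\<dots> = (\<integral>\<^sup>+x. 1 \<partial>M)"
  proof (intro nn_integral_cong)
    fix x
    have "(\<integral>\<^sup>+y. ennreal (g y) * ennreal (k x y * f x) \<partial>N) = (\<integral>\<^sup>+y. ennreal (f x) * ennreal (k x y * g y) \<partial>N)"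
      using weight_pos op.weight_pos[OF f] k_pos
      by (intro nn_integral_cong) (simp add: ennreal_mult[symmetric] less_imp_le mult_ac)
    also have "\<dots> = ennreal (f x) * ennreal (1 / f x)"
      by (simp add: nn_integral_cmult nn_integral_kernel_weight f_def)
    also have "\<dots> = 1" using op.weight_pos[OF f, of x] by (simp add: ennreal_mult[symmetric] less_imp_le)
    finally show "(\<integral>\<^sup>+y. ennreal (g y) * ennreal (k x y * f x) \<partial>N) = 1" .
  qed
  finally show ?thesis by (simp add: f_def M.emeasure_space_1)
qed

end

text \<open>
  The quotient of the images, \<open>scaling k N g / scaling k N h\<close>, is the average of \<open>h/g\<close> with respect to the
  probability density \<open>k(x,y) g(y) / \<integral>k(x,\<cdot>) g\<close>, which dominates \<open>a\<^sup>2\<close> times the normalization of \<open>g\<close>.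
  So it is a mixture, with weight \<open>\<delta>\<close>, of the global mean \<open>m\<close> of \<open>h/g\<close> and of some value between \<open>\<alpha>\<close>
  and \<open>\<beta>\<close>. The half-step reverses the order of the two weights.
\<close>
lemma scaling_contraction:
  assumes g: "weight N g" and h: "weight N h" and \<delta>: "0 \<le> \<delta>" "\<delta> \<le> a\<^sup>2"
    and \<alpha>\<beta>: "\<And>y. \<alpha> * g y \<le> h y" "\<And>y. h y \<le> \<beta> * g y"
  obtains \<alpha>' \<beta>' where "\<alpha> \<le> \<alpha>'" "\<beta>' \<le> \<beta>" "\<beta>' - \<alpha>' \<le> (1 - \<delta>) * (\<beta> - \<alpha>)"
    "\<And>x. \<alpha>' * scaling k N h x \<le> scaling k N g x" "\<And>x. scaling k N g x \<le> \<beta>' * scaling k N h x"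
proof -
  note int = weight_integrable[OF g] weight_integrable[OF h] integrable_kernel[OF g] integrable_kernel[OF h]
  define G H where "G = (\<integral>y. g y \<partial>N)" and "H = (\<integral>y. h y \<partial>N)"
  have G: "0 < G" unfolding G_def by (rule weight_integral_pos[OF g])
  define m where "m = H / G"
  have H: "H = m * G" using G by (simp add: m_def)
  have "\<alpha> * G \<le> H" "H \<le> \<beta> * G"
    unfolding G_def H_def using integral_mono[of N "\<lambda>y. \<alpha> * g y" h] integral_mono[of N h "\<lambda>y. \<beta> * g y"] int \<alpha>\<beta> by auto
  then have m: "\<alpha> \<le> m" "m \<le> \<beta>" using G by (auto simp: m_def field_simps)
  have key: "(\<alpha> + \<delta> * (m - \<alpha>)) * A \<le> B \<and> B \<le> (\<beta> - \<delta> * (\<beta> - m)) * A"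
    if AB: "A = (\<integral>y. k x y * g y \<partial>N)" "B = (\<integral>y. k x y * h y \<partial>N)" for A B x
  proof -
    have A: "A \<le> 1 / a * G" unfolding AB G_def by (rule kernel_integral_le[OF g])
    have "\<delta> * A \<le> a\<^sup>2 * A"
      using \<delta> kernel_integral_pos[OF g, of x] unfolding AB by (intro mult_right_mono) auto
    also have "\<dots> \<le> a\<^sup>2 * (1 / a * G)" using A by (intro mult_left_mono) auto
    also have "\<dots> = a * G" using a by (simp add: power2_eq_square)
    finally have \<delta>A: "\<delta> * A \<le> a * G" .
    have "a * (H - \<alpha> * G) = (\<integral>y. a * (h y - \<alpha> * g y) \<partial>N)"
      unfolding G_def H_def using int by simp
    also have "\<dots> \<le> (\<integral>y. k x y * (h y - \<alpha> * g y) \<partial>N)"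
      using int k_bounds(1) \<alpha>\<beta>(1)
      by (intro integral_mono mult_right_mono) (auto simp: algebra_simps)
    also have "\<dots> = B - \<alpha> * A"
      unfolding AB using int by (simp add: algebra_simps)
    finally have "(a * G) * (m - \<alpha>) \<le> B - \<alpha> * A" by (simp add: H algebra_simps)
    moreover have "(\<delta> * A) * (m - \<alpha>) \<le> (a * G) * (m - \<alpha>)"
      using \<delta>A m by (intro mult_right_mono) auto
    ultimately have lower: "(\<delta> * A) * (m - \<alpha>) \<le> B - \<alpha> * A" by simp
    have "a * (\<beta> * G - H) = (\<integral>y. a * (\<beta> * g y - h y) \<partial>N)"
      unfolding G_def H_def using int by simp
    also have "\<dots> \<le> (\<integral>y. k x y * (\<beta> * g y - h y) \<partial>N)"
      using int k_bounds(1) \<alpha>\<beta>(2)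
      by (intro integral_mono mult_right_mono) (auto simp: algebra_simps)
    also have "\<dots> = \<beta> * A - B"
      unfolding AB using int by (simp add: algebra_simps)
    finally have "(a * G) * (\<beta> - m) \<le> \<beta> * A - B" by (simp add: H algebra_simps)
    moreover have "(\<delta> * A) * (\<beta> - m) \<le> (a * G) * (\<beta> - m)"
      using \<delta>A m by (intro mult_right_mono) auto
    ultimately have "(\<delta> * A) * (\<beta> - m) \<le> \<beta> * A - B" by simp
    with lower show ?thesis by (simp add: algebra_simps)
  qed
  show ?thesis
  proof (rule that[of "\<alpha> + \<delta> * (m - \<alpha>)" "\<beta> - \<delta> * (\<beta> - m)"])
    fix x
    show "(\<alpha> + \<delta> * (m - \<alpha>)) * scaling k N h x \<le> scaling k N g x"
      "scaling k N g x \<le> (\<beta> - \<delta> * (\<beta> - m)) * scaling k N h x"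
      using key[OF refl refl, of x] kernel_integral_pos[OF g, of x] kernel_integral_pos[OF h, of x]
      by (auto simp: scaling_def field_simps)
  qed (use \<delta> m mult_left_mono[OF m(1), of \<delta>] mult_left_mono[OF m(2), of \<delta>] in \<open>auto simp: algebra_simps\<close>)
qed

text \<open>Without loss (\<open>\<delta> = 0\<close>) the same averaging argument gives a bound for the supremum norm of logarithms.\<close>
lemma scaling_ln_nonexpansive:
  assumes g: "weight N g" and h: "weight N h" and e: "\<And>y. \<bar>ln (g y) - ln (h y)\<bar> \<le> e"
  shows "\<bar>ln (scaling k N g x) - ln (scaling k N h x)\<bar> \<le> e"
proof -
  have "exp (- e) * g y \<le> h y" "h y \<le> exp e * g y" for y
    using e[of y] abs_ln_diff_le_iff[of "h y" "g y" e] weight_pos[OF g] weight_pos[OF h]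
    by (auto simp: abs_minus_commute)
  then obtain \<alpha> \<beta> where \<alpha>\<beta>: "exp (- e) \<le> \<alpha>" "\<beta> \<le> exp e"
    "\<alpha> * scaling k N h x \<le> scaling k N g x" "scaling k N g x \<le> \<beta> * scaling k N h x"
    using scaling_contraction[OF g h, of 0 "exp (- e)" "exp e"] by (metis order_refl zero_le_power2)
  have "exp (- e) * scaling k N h x \<le> \<alpha> * scaling k N h x" "\<beta> * scaling k N h x \<le> exp e * scaling k N h x"
    using \<alpha>\<beta> scaling_pos[OF h, of x] by (auto intro!: mult_right_mono)
  then show ?thesis
    using \<alpha>\<beta> by (subst abs_ln_diff_le_iff[OF scaling_pos[OF g] scaling_pos[OF h]]) auto
qed

text \<open>
  The transition has density \<open>k(x,y) f(x) g'(y)\<close>. It is normalized in \<open>x\<close> by the choice of \<open>g'\<close>, it carries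
  \<open>(g/g') N\<close> to \<open>M\<close> by the choice of \<open>f\<close>, and \<open>k \<ge> a\<close> together with the lower bound on \<open>g'\<close> gives the
  minorization \<open>a\<^sup>2 f / \<integral>f\<close>.
\<close>
lemma entropy_scaling_contraction:
  assumes \<Phi>: "entropy_function \<Phi>" and g: "weight N g"
    and f_def: "f = scaling k N g" and g'_def: "g' = scaling (\<lambda>y x. k x y) M f"
  shows "ereal_integral M (\<lambda>x. \<Phi> (f x / scaling k N g' x) 1)
      \<le> ereal (1 - a\<^sup>2 / 2) * ereal_integral N (\<lambda>y. \<Phi> 1 (g y / g' y))"
proof -
  interpret op: bounded_kernel N M "\<lambda>y x. k x y" a by (rule swap)
  have f: "weight M f" unfolding f_def by (rule weight_scaling[OF g])
  have g': "weight N g'" unfolding g'_def by (rule op.weight_scaling[OF f])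
  note [measurable] = weight_measurable[OF g] weight_measurable[OF g'] op.weight_measurable[OF f]
    scaling_measurable[OF g'] op.k_measurable
  note pos = weight_pos[OF g] weight_pos[OF g'] op.weight_pos[OF f] scaling_pos[OF g'] k_pos
  define F where "F = (\<integral>x. f x \<partial>M)"
  have F: "0 < F" unfolding F_def by (rule op.weight_integral_pos[OF f])
  have a2: "0 < a\<^sup>2" "a\<^sup>2 < 1" using a by (auto simp: power_less_one_iff)
  show ?thesis
  proof (rule entropy_contraction_step[OF \<Phi> M.prob_space_axioms N.prob_space_axioms,
      where s="\<lambda>y x. k x y * f x * g' y" and m="\<lambda>x. f x / F"])
    show "(\<integral>\<^sup>+x. ennreal (f x / F) \<partial>M) = 1"
      using F pos op.weight_integrable[OF f]
      by (subst nn_integral_eq_integral) (auto simp: F_def[symmetric] less_imp_le)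
    show "2 * (a\<^sup>2 / 2) * (f x / F) \<le> k x y * f x * g' y" for x y
    proof -
      have "a * f x * (a / F) \<le> k x y * f x * g' y"
        using k_bounds(1)[of x y] op.scaling_ge[OF f, of y] a F pos
        by (intro mult_mono) (auto simp: g'_def F_def less_imp_le intro!: mult_right_mono)
      then show ?thesis by (simp add: power2_eq_square mult_ac)
    qed
    show "(\<integral>\<^sup>+x. ennreal (k x y * f x * g' y) \<partial>M) = 1" for y
    proof -
      have "(\<integral>\<^sup>+x. ennreal (k x y * f x * g' y) \<partial>M) = (\<integral>\<^sup>+x. ennreal (k x y * f x) * ennreal (g' y) \<partial>M)"
        using pos by (intro nn_integral_cong) (auto simp: ennreal_mult[symmetric] less_imp_le)
      also have "\<dots> = ennreal (1 / g' y) * ennreal (g' y)"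
        by (simp add: nn_integral_multc op.nn_integral_kernel_weight[OF f] g'_def)
      finally show ?thesis using pos(2)[of y] by (simp add: ennreal_mult[symmetric] less_imp_le)
    qed
    show "(\<integral>\<^sup>+y. ennreal (g y / g' y) \<partial>N) = 1"
      unfolding g'_def f_def by (rule nn_integral_ratio_scaling_scaling[OF g])
    show "(\<integral>\<^sup>+y. ennreal (k x y * f x * g' y * (g y / g' y)) \<partial>N) = 1" for x
    proof -
      have "(\<integral>\<^sup>+y. ennreal (k x y * f x * g' y * (g y / g' y)) \<partial>N) = (\<integral>\<^sup>+y. ennreal (f x) * ennreal (k x y * g y) \<partial>N)"
        using pos(2) less_imp_neq[OF pos(2), symmetric] pos
        by (intro nn_integral_cong) (auto simp: ennreal_mult[symmetric] less_imp_le mult_ac)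
      also have "\<dots> = ennreal (f x) * ennreal (1 / f x)"
        by (simp add: nn_integral_cmult nn_integral_kernel_weight[OF g] f_def)
      finally show ?thesis using pos(3)[of x] by (simp add: ennreal_mult[symmetric] less_imp_le)
    qed
    show "(\<integral>\<^sup>+y. ennreal (k x y * f x * g' y) \<partial>N) = ennreal (f x / scaling k N g' x)" for x
    proof -
      have "(\<integral>\<^sup>+y. ennreal (k x y * f x * g' y) \<partial>N) = (\<integral>\<^sup>+y. ennreal (f x) * ennreal (k x y * g' y) \<partial>N)"
        using pos by (intro nn_integral_cong) (auto simp: ennreal_mult[symmetric] less_imp_le mult_ac)
      also have "\<dots> = ennreal (f x) * ennreal (1 / scaling k N g' x)"
        by (simp add: nn_integral_cmult nn_integral_kernel_weight[OF g'])
      finally show ?thesis using pos by (simp add: ennreal_mult[symmetric] less_imp_le)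
    qed
  qed (use a2 F pos in auto)
qed

end

section \<open>Convergence of the iterated half-steps\<close>

lemma geometric_increments_limit:
  fixes u :: "nat \<Rightarrow> real"
  assumes inc: "\<And>n. \<bar>u (Suc n) - u n\<bar> \<le> C * \<rho> ^ n" and \<rho>: "0 < \<rho>" "\<rho> < 1"
  obtains l where "u \<longlonglongrightarrow> l" "\<And>n. \<bar>u n - l\<bar> \<le> C / (1 - \<rho>) * \<rho> ^ n"
proof -
  have C: "0 \<le> C" using inc[of 0] by simp
  have dist: "\<bar>u (n + j) - u n\<bar> \<le> C / (1 - \<rho>) * \<rho> ^ n * (1 - \<rho> ^ j)" for n j
  proof (induction j)
    case (Suc j)
    have "\<bar>u (n + Suc j) - u n\<bar> \<le> C * \<rho> ^ (n + j) + C / (1 - \<rho>) * \<rho> ^ n * (1 - \<rho> ^ j)"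
      using Suc inc[of "n + j"] by simp
    also have "\<dots> = C / (1 - \<rho>) * \<rho> ^ n * (1 - \<rho> ^ Suc j)"
      using \<rho> by (simp add: field_simps power_add)
    finally show ?case .
  qed simp
  have "summable (\<lambda>n. C * \<rho> ^ n)" using \<rho> by (intro summable_mult summable_geometric) auto
  then have "summable (\<lambda>n. u (Suc n) - u n)"
    by (rule summable_comparison_test[rotated]) (use inc in auto)
  then have "convergent (\<lambda>n. \<Sum>i<n. u (Suc i) - u i)" by (simp add: summable_iff_convergent)
  then have "convergent (\<lambda>n. u n - u 0)" by (simp add: sum_lessThan_telescope)
  then have "convergent (\<lambda>n. (u n - u 0) + u 0)" by (intro convergent_add convergent_const)
  then obtain l where l: "u \<longlonglongrightarrow> l" by (auto simp: convergent_def)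
  show ?thesis
  proof (rule that[OF l])
    fix n
    have "(\<lambda>j. \<bar>u (j + n) - u n\<bar>) \<longlonglongrightarrow> \<bar>l - u n\<bar>"
      by (intro tendsto_intros LIMSEQ_ignore_initial_segment l)
    moreover have "\<bar>u (j + n) - u n\<bar> \<le> C / (1 - \<rho>) * \<rho> ^ n" for j
    proof -
      have "C / (1 - \<rho>) * \<rho> ^ n * (1 - \<rho> ^ j) \<le> C / (1 - \<rho>) * \<rho> ^ n * 1"
        using \<rho> C by (intro mult_left_mono) auto
      then show ?thesis using dist[of n j] by (simp add: add.commute)
    qed
    ultimately have "\<bar>l - u n\<bar> \<le> C / (1 - \<rho>) * \<rho> ^ n" by (intro LIMSEQ_le_const2) auto
    then show "\<bar>u n - l\<bar> \<le> C / (1 - \<rho>) * \<rho> ^ n" by (simp add: abs_minus_commute)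
  qed
qed

locale scaling_iteration = bounded_kernel +
  fixes g\<^sub>0 :: "'b \<Rightarrow> real"
  assumes weight_g\<^sub>0: "weight N g\<^sub>0"
begin

sublocale op: bounded_kernel N M "\<lambda>y x. k x y" a
  by (rule swap)

primrec gs :: "nat \<Rightarrow> 'b \<Rightarrow> real" where
  "gs 0 = g\<^sub>0"
| "gs (Suc n) = scaling (\<lambda>y x. k x y) M (scaling k N (gs n))"

definition fs :: "nat \<Rightarrow> 'a \<Rightarrow> real" where
  "fs n = scaling k N (gs n)"

lemma gs_Suc: "gs (Suc n) = scaling (\<lambda>y x. k x y) M (fs n)"
  by (simp add: fs_def)

lemma weight_gs: "weight N (gs n)"
  by (induction n) (auto simp: weight_g\<^sub>0 weight_scaling op.weight_scaling)

declare gs.simps(2)[simp del]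

lemma weight_fs: "weight M (fs n)"
  unfolding fs_def by (rule weight_scaling[OF weight_gs])

lemmas gs_pos = weight_pos[OF weight_gs] and fs_pos = op.weight_pos[OF weight_fs]

lemma gs_measurable[measurable]: "gs n \<in> borel_measurable N"
  and fs_measurable[measurable]: "fs n \<in> borel_measurable M"
  by (rule weight_measurable[OF weight_gs] op.weight_measurable[OF weight_fs])+

text \<open>
  The \<open>\<Phi>\<close>-entropies of the marginals of the even and of the odd iterates, in the form on which the
  half-steps act.
\<close>
definition entropy_N :: "(real \<Rightarrow> real \<Rightarrow> ereal) \<Rightarrow> nat \<Rightarrow> ereal" where
  "entropy_N \<Phi> n = ereal_integral N (\<lambda>y. \<Phi> (gs n y / gs (Suc n) y) 1)"

definition entropy_M :: "(real \<Rightarrow> real \<Rightarrow> ereal) \<Rightarrow> nat \<Rightarrow> ereal" where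
  "entropy_M \<Phi> n = ereal_integral M (\<lambda>x. \<Phi> (fs n x / fs (Suc n) x) 1)"

text \<open>Square of the loss of a half-step, since a full iteration consists of two half-steps.\<close>
definition rate :: real where "rate = (1 - a\<^sup>2 / 2)\<^sup>2"

lemma half_rate: "0 < 1 - a\<^sup>2 / 2" "1 - a\<^sup>2 / 2 < 1"
proof -
  have "0 < a\<^sup>2" "a\<^sup>2 < 1" using a by (auto simp: power_less_one_iff)
  then show "0 < 1 - a\<^sup>2 / 2" "1 - a\<^sup>2 / 2 < 1" by auto
qed

lemma rate: "0 < rate" "rate < 1"
  using half_rate by (auto simp: rate_def power_less_one_iff)

text \<open>
  A half-step exchanges the two arguments of \<open>\<Phi>\<close>; after two of them the original order is restored.
\<close>
lemma entropy_half_step: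
  assumes \<Phi>: "entropy_function \<Phi>"
  shows "entropy_M \<Phi> n \<le> ereal (1 - a\<^sup>2 / 2) * entropy_N (\<lambda>u v. \<Phi> v u) n"
    and "entropy_N \<Phi> (Suc n) \<le> ereal (1 - a\<^sup>2 / 2) * entropy_M (\<lambda>u v. \<Phi> v u) n"
  unfolding entropy_M_def entropy_N_def
  using entropy_scaling_contraction[OF \<Phi> weight_gs[of n] fs_def[of n] gs_Suc[of n]]
    op.entropy_scaling_contraction[OF \<Phi> weight_fs[of n] gs_Suc[of n] fs_def[of "Suc n"]]
  by (simp_all only: fs_def[of "Suc n", symmetric] gs_Suc[symmetric])

lemma two_half_steps:
  assumes "X \<le> ereal (1 - a\<^sup>2 / 2) * Y" "Y \<le> ereal (1 - a\<^sup>2 / 2) * Z"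
  shows "X \<le> ereal rate * Z"
proof -
  have "X \<le> ereal (1 - a\<^sup>2 / 2) * (ereal (1 - a\<^sup>2 / 2) * Z)"
    using half_rate by (intro order_trans[OF assms(1)] ereal_mult_left_mono[OF assms(2)]) auto
  also have "\<dots> = ereal rate * Z" by (simp add: rate_def power2_eq_square mult.assoc[symmetric])
  finally show ?thesis .
qed

lemma geometric_ereal:
  assumes step: "\<And>n. X (Suc n) \<le> ereal rate * X n"
  shows "X n \<le> ereal (rate ^ n) * X 0"
proof (induction n)
  case 0
  then show ?case by (simp add: one_ereal_def[symmetric])
next
  case (Suc n)
  have "X (Suc n) \<le> ereal rate * (ereal (rate ^ n) * X 0)"
    using rate by (intro order_trans[OF step[of n]] ereal_mult_left_mono[OF Suc]) auto
  then show ?case by (simp add: mult.assoc[symmetric])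
qed

lemma entropy_decay:
  assumes \<Phi>: "entropy_function \<Phi>"
  shows "entropy_N \<Phi> n \<le> ereal (rate ^ n) * entropy_N \<Phi> 0"
    and "entropy_M \<Phi> n \<le> ereal (rate ^ n) * entropy_M \<Phi> 0"
proof -
  note half = entropy_half_step[OF \<Phi>] entropy_half_step[OF entropy_function_swap[OF \<Phi>]]
  show "entropy_N \<Phi> n \<le> ereal (rate ^ n) * entropy_N \<Phi> 0"
    by (rule geometric_ereal[of "entropy_N \<Phi>"], rule two_half_steps[OF half(2) half(3)])
  show "entropy_M \<Phi> n \<le> ereal (rate ^ n) * entropy_M \<Phi> 0"
    by (rule geometric_ereal[of "entropy_M \<Phi>"], rule two_half_steps[OF half(1) half(4)])
qed

text \<open>
  Already the first two iterates \<open>f\<^sub>0\<close> and \<open>f\<^sub>1\<close> are images of a half-step, hence bounded above and away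
  from zero, even if \<open>g\<^sub>0\<close> is not. From there on \<open>scaling_contraction\<close> is applied twice per iteration,
  and the lower bound of the ratio never decreases.
\<close>
lemma ratio_bounds:
  obtains \<alpha>0 D where "0 < \<alpha>0" "\<alpha>0 \<le> 1" "0 \<le> D"
    "\<And>n. \<exists>\<alpha> \<beta>. \<alpha>0 \<le> \<alpha> \<and> \<beta> - \<alpha> \<le> D * rate ^ n \<and> (\<forall>x. \<alpha> * fs n x \<le> fs (Suc n) x \<and> fs (Suc n) x \<le> \<beta> * fs n x)"
proof -
  define G where "G i = (\<integral>y. gs i y \<partial>N)" for i
  have G: "0 < G i" for i unfolding G_def by (rule weight_integral_pos[OF weight_gs])
  have f_ge: "a / G i \<le> fs i x" and f_le: "fs i x \<le> 1 / (a * G i)" for i x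
    using scaling_ge[OF weight_gs[of i], of x] scaling_le[OF weight_gs[of i], of x] by (auto simp: fs_def G_def)
  \<comment> \<open>Quotients of the bounds \<open>scaling_ge\<close> and \<open>scaling_le\<close> for \<open>f\<^sub>1\<close> and \<open>f\<^sub>0\<close>.\<close>
  define \<alpha>0 \<beta>0 where "\<alpha>0 = a\<^sup>2 * G 0 / G 1" and "\<beta>0 = G 0 / (a\<^sup>2 * G 1)"
  have \<alpha>0: "0 < \<alpha>0" using G a by (simp add: \<alpha>0_def)
  have start: "\<alpha>0 * fs 0 x \<le> fs (Suc 0) x \<and> fs (Suc 0) x \<le> \<beta>0 * fs 0 x" for x
  proof
    have "\<alpha>0 * fs 0 x \<le> \<alpha>0 * (1 / (a * G 0))" using \<alpha>0 f_le by (intro mult_left_mono) auto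
    also have "\<dots> = a / G 1" using a G[of 0] by (simp add: \<alpha>0_def power2_eq_square)
    also have "\<dots> \<le> fs (Suc 0) x" using f_ge[of 1] by simp
    finally show "\<alpha>0 * fs 0 x \<le> fs (Suc 0) x" .
    have "fs (Suc 0) x \<le> 1 / (a * G 1)" using f_le[of 1] by simp
    also have "\<dots> = \<beta>0 * (a / G 0)" using a G[of 0] by (simp add: \<beta>0_def power2_eq_square)
    also have "\<dots> \<le> \<beta>0 * fs 0 x" using f_ge[of 0] G a by (intro mult_left_mono) (auto simp: \<beta>0_def less_imp_le)
    finally show "fs (Suc 0) x \<le> \<beta>0 * fs 0 x" .
  qed
  have D: "0 \<le> \<beta>0 - \<alpha>0"
  proof -
    have "\<alpha>0 * fs 0 undefined \<le> \<beta>0 * fs 0 undefined" using start[of undefined] by linarith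
    then show ?thesis using fs_pos[of 0 undefined] by simp
  qed
  have "\<exists>\<alpha> \<beta>. \<alpha>0 \<le> \<alpha> \<and> \<beta> - \<alpha> \<le> (\<beta>0 - \<alpha>0) * rate ^ n
      \<and> (\<forall>x. \<alpha> * fs n x \<le> fs (Suc n) x \<and> fs (Suc n) x \<le> \<beta> * fs n x)" for n
  proof (induction n)
    case 0
    show ?case using start by (intro exI[of _ \<alpha>0] exI[of _ \<beta>0]) auto
  next
    case (Suc n)
    then obtain \<alpha> \<beta> where *: "\<alpha>0 \<le> \<alpha>" "\<beta> - \<alpha> \<le> (\<beta>0 - \<alpha>0) * rate ^ n"
      "\<And>x. \<alpha> * fs n x \<le> fs (Suc n) x" "\<And>x. fs (Suc n) x \<le> \<beta> * fs n x" by blast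
    define \<delta> where "\<delta> = a\<^sup>2 / 2"
    have \<delta>: "0 \<le> \<delta>" "\<delta> \<le> a\<^sup>2" by (auto simp: \<delta>_def)
    obtain \<alpha>' \<beta>' where 1: "\<alpha> \<le> \<alpha>'" "\<beta>' - \<alpha>' \<le> (1 - \<delta>) * (\<beta> - \<alpha>)"
      "\<And>y. \<alpha>' * gs (Suc (Suc n)) y \<le> gs (Suc n) y" "\<And>y. gs (Suc n) y \<le> \<beta>' * gs (Suc (Suc n)) y"
      unfolding gs_Suc
      by (rule op.scaling_contraction[OF weight_fs weight_fs \<delta> *(3,4)]) blast
    obtain \<alpha>'' \<beta>'' where 2: "\<alpha>' \<le> \<alpha>''" "\<beta>'' - \<alpha>'' \<le> (1 - \<delta>) * (\<beta>' - \<alpha>')"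
      "\<And>y. \<alpha>'' * fs (Suc n) y \<le> fs (Suc (Suc n)) y" "\<And>y. fs (Suc (Suc n)) y \<le> \<beta>'' * fs (Suc n) y"
      unfolding fs_def
      by (rule scaling_contraction[OF weight_gs weight_gs \<delta> 1(3,4)]) blast
    have "\<beta>'' - \<alpha>'' \<le> (1 - \<delta>) * ((1 - \<delta>) * (\<beta> - \<alpha>))"
      using 2(2) mult_left_mono[OF 1(2), of "1 - \<delta>"] half_rate unfolding \<delta>_def by linarith
    also have "\<dots> = rate * (\<beta> - \<alpha>)" by (simp add: rate_def \<delta>_def power2_eq_square)
    also have "\<dots> \<le> rate * ((\<beta>0 - \<alpha>0) * rate ^ n)" using *(2) rate by (intro mult_left_mono) auto
    finally have "\<beta>'' - \<alpha>'' \<le> (\<beta>0 - \<alpha>0) * rate ^ Suc n" by (simp add: mult_ac)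
    then show ?case using * 1 2 by (intro exI[of _ \<alpha>''] exI[of _ \<beta>'']) auto
  qed
  then have "\<exists>\<alpha> \<beta>. min \<alpha>0 1 \<le> \<alpha> \<and> \<beta> - \<alpha> \<le> (\<beta>0 - \<alpha>0) * rate ^ n
      \<and> (\<forall>x. \<alpha> * fs n x \<le> fs (Suc n) x \<and> fs (Suc n) x \<le> \<beta> * fs n x)" for n
    by (meson min.coboundedI1)
  with \<alpha>0 D show ?thesis by (intro that[of "min \<alpha>0 1" "\<beta>0 - \<alpha>0"]) auto
qed

lemma mean_ratio: "(\<integral>\<^sup>+x. ennreal (fs n x / fs (Suc n) x) \<partial>M) = 1"
  using op.nn_integral_ratio_scaling_scaling[OF weight_fs[of n]]
  unfolding gs_Suc[symmetric] fs_def[of "Suc n", symmetric] .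

text \<open>
  By \<open>mean_ratio\<close> the number \<open>1\<close> lies between the bounds of \<open>f\<^sub>n\<^sub>+\<^sub>1/f\<^sub>n\<close>, which are geometrically close
  to each other and uniformly positive.
\<close>
lemma log_ratio_decay:
  "\<exists>C>0. \<forall>n x. \<bar>ln (fs (Suc n) x) - ln (fs n x)\<bar> \<le> C * rate ^ n"
proof -
  obtain \<alpha>0 D where \<alpha>0: "0 < \<alpha>0" "\<alpha>0 \<le> 1" and D: "0 \<le> D"
    and ex: "\<And>n. \<exists>\<alpha> \<beta>. \<alpha>0 \<le> \<alpha> \<and> \<beta> - \<alpha> \<le> D * rate ^ n \<and> (\<forall>x. \<alpha> * fs n x \<le> fs (Suc n) x \<and> fs (Suc n) x \<le> \<beta> * fs n x)"
    using ratio_bounds by blast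
  define C where "C = D / \<alpha>0 + 1"
  have C: "0 < C" using D \<alpha>0 by (simp add: C_def add_nonneg_pos)
  have f: "\<bar>ln (fs (Suc n) x) - ln (fs n x)\<bar> \<le> C * rate ^ n" for n x
  proof -
    obtain \<alpha> \<beta> where \<alpha>\<beta>: "\<alpha>0 \<le> \<alpha>" "\<beta> - \<alpha> \<le> D * rate ^ n"
      "\<And>x. \<alpha> * fs n x \<le> fs (Suc n) x" "\<And>x. fs (Suc n) x \<le> \<beta> * fs n x" using ex[of n] by blast
    have \<alpha>: "0 < \<alpha>" using \<alpha>\<beta> \<alpha>0 by simp
    have "\<alpha> * fs n undefined \<le> \<beta> * fs n undefined" using \<alpha>\<beta>(3,4)[of undefined] by linarith
    then have "\<alpha> \<le> \<beta>" using fs_pos[of n undefined] by simp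
    then have \<beta>: "0 < \<beta>" using \<alpha> by simp
    have "(1::ennreal) \<le> (\<integral>\<^sup>+x. ennreal (1 / \<alpha>) \<partial>M)"
      unfolding mean_ratio[of n, symmetric] using \<alpha>\<beta>(3) \<alpha> fs_pos
      by (intro nn_integral_mono ennreal_leI) (simp add: field_simps)
    then have "\<alpha> \<le> 1" using \<alpha> by (simp add: M.emeasure_space_1 field_simps)
    have "(\<integral>\<^sup>+x. ennreal (1 / \<beta>) \<partial>M) \<le> 1"
      unfolding mean_ratio[of n, symmetric] using \<alpha>\<beta>(4) \<beta> fs_pos
      by (intro nn_integral_mono ennreal_leI) (simp add: field_simps)
    then have "1 \<le> \<beta>" using \<beta> by (simp add: M.emeasure_space_1 field_simps)
    define e where "e = C * rate ^ n"
    have "D * rate ^ n / \<alpha>0 \<le> e"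
      using rate by (simp add: e_def C_def algebra_simps)
    moreover have "(\<beta> - \<alpha>) / \<alpha>0 \<le> D * rate ^ n / \<alpha>0"
      using \<alpha>\<beta>(2) \<alpha>0 by (intro divide_right_mono) auto
    ultimately have e: "(\<beta> - \<alpha>) / \<alpha>0 \<le> e" by simp
    then have e': "\<beta> - \<alpha> \<le> \<alpha>0 * e" using \<alpha>0 by (simp add: field_simps)
    have "0 \<le> e" using C rate by (simp add: e_def)
    \<comment> \<open>Both bounds are compared with \<open>exp (\<plusminus> e)\<close> through \<open>1 + e \<le> exp e\<close>; the lower one is \<open>1 / (1 + e) \<le> \<alpha>\<close>.\<close>
    have "\<alpha>0 * e \<le> \<alpha> * e" "\<alpha>0 * e \<le> 1 * e"
      using \<alpha>\<beta>(1) \<alpha>0 \<open>0 \<le> e\<close> by (intro mult_right_mono; simp)+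
    then have "\<beta> \<le> 1 + e" "1 \<le> \<alpha> * (1 + e)"
      using e' \<open>\<alpha> \<le> 1\<close> \<open>1 \<le> \<beta>\<close> by (auto simp: algebra_simps)
    moreover have exp: "1 + e \<le> exp e" by (rule exp_ge_add_one_self)
    moreover have "\<alpha> * (1 + e) \<le> \<alpha> * exp e" using exp \<alpha> by (intro mult_left_mono) auto
    ultimately have "\<beta> \<le> exp e" "1 \<le> \<alpha> * exp e" by linarith+
    then have "exp (- e) \<le> \<alpha>" by (simp add: exp_minus field_simps)
    have "exp (- e) * fs n x \<le> \<alpha> * fs n x" "\<beta> * fs n x \<le> exp e * fs n x"
      using \<open>exp (- e) \<le> \<alpha>\<close> \<open>\<beta> \<le> exp e\<close> fs_pos[of n x] by (auto intro!: mult_right_mono)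
    then show ?thesis
      using \<alpha>\<beta>(3,4)[of x] unfolding e_def[symmetric]
      by (subst abs_ln_diff_le_iff[OF fs_pos fs_pos]) auto
  qed
  with C show ?thesis by auto
qed

text \<open>
  The limit \<open>f\<close> comes from geometric increments, \<open>g\<close> is its image, and nonexpansiveness carries the
  convergence through the half-steps. That \<open>f\<close> is in turn the image of \<open>g\<close> is uniqueness of limits.
\<close>
lemma scaling_limit:
  "\<exists>f g C. weight M f \<and> weight N g \<and> scaling k N g = f \<and> scaling (\<lambda>y x. k x y) M f = g \<and> 0 < C
    \<and> (\<forall>n x. \<bar>ln (fs n x) - ln (f x)\<bar> \<le> C * rate ^ n)
    \<and> (\<forall>n y. \<bar>ln (gs (Suc n) y) - ln (g y)\<bar> \<le> C * rate ^ n)"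
proof -
  obtain C0 where C0: "0 < C0" "\<And>n x. \<bar>ln (fs (Suc n) x) - ln (fs n x)\<bar> \<le> C0 * rate ^ n"
    using log_ratio_decay by metis
  define C where "C = C0 / (1 - rate)"
  have C: "0 < C" using C0 rate by (simp add: C_def)
  have "\<exists>l. (\<lambda>n. ln (fs n x)) \<longlonglongrightarrow> l \<and> (\<forall>n. \<bar>ln (fs n x) - l\<bar> \<le> C * rate ^ n)" for x
    using geometric_increments_limit[of "\<lambda>n. ln (fs n x)", OF C0(2) rate] unfolding C_def by metis
  then obtain L where L: "\<And>x. (\<lambda>n. ln (fs n x)) \<longlonglongrightarrow> L x" "\<And>n x. \<bar>ln (fs n x) - L x\<bar> \<le> C * rate ^ n"
    by metis
  define f where "f x = exp (L x)" for x
  have f_pos: "0 < f x" and ln_f: "ln (f x) = L x" for x by (auto simp: f_def)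
  have [measurable]: "L \<in> borel_measurable M"
    by (rule borel_measurable_LIMSEQ_real[OF L(1)]) measurable
  have [measurable]: "f \<in> borel_measurable M" unfolding f_def[abs_def] by measurable
  have "weight M f"
  proof -
    have "f x \<le> exp C * fs 0 x" for x
      using L(2)[of 0 x] abs_ln_diff_le_iff[OF f_pos fs_pos, of x 0 x C]
      by (simp add: ln_f abs_minus_commute)
    then have "integrable M f"
      using f_pos fs_pos op.weight_integrable[OF weight_fs[of 0]]
      by (intro Bochner_Integration.integrable_bound[of M "\<lambda>x. exp C * fs 0 x" f])
         (auto intro!: AE_I2 simp: less_imp_le)
    then show ?thesis using f_pos by (simp add: weight_def)
  qed
  define g where "g = scaling (\<lambda>y x. k x y) M f"
  have "weight N g" unfolding g_def by (rule op.weight_scaling) fact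
  have close_f: "\<bar>ln (fs n x) - ln (f x)\<bar> \<le> C * rate ^ n" for n x using L(2) by (simp add: ln_f)
  have close_g: "\<bar>ln (gs (Suc n) y) - ln (g y)\<bar> \<le> C * rate ^ n" for n y
    unfolding gs_Suc g_def by (rule op.scaling_ln_nonexpansive[OF weight_fs \<open>weight M f\<close> close_f])
  have close_f': "\<bar>ln (fs (Suc n) x) - ln (scaling k N g x)\<bar> \<le> C * rate ^ n" for n x
    unfolding fs_def by (rule scaling_ln_nonexpansive[OF weight_gs \<open>weight N g\<close> close_g])
  have "scaling k N g x = f x" for x
  proof -
    have "(\<lambda>n. ln (fs (Suc n) x) - ln (scaling k N g x)) \<longlonglongrightarrow> 0"
    proof (rule Lim_null_comparison)
      show "\<forall>\<^sub>F n in sequentially. norm (ln (fs (Suc n) x) - ln (scaling k N g x)) \<le> C * rate ^ n"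
        using close_f'[of _ x] by simp
      show "(\<lambda>n. C * rate ^ n) \<longlonglongrightarrow> 0"
        using rate by (intro tendsto_mult_right_zero LIMSEQ_power_zero) auto
    qed
    then have "(\<lambda>n. ln (fs (Suc n) x)) \<longlonglongrightarrow> ln (scaling k N g x)" by (simp add: LIM_zero_iff)
    then have "ln (scaling k N g x) = L x"
      using LIMSEQ_Suc[OF L(1)[of x]] by (rule LIMSEQ_unique)
    then show ?thesis
      using scaling_pos[OF \<open>weight N g\<close>, of x] by (metis exp_ln f_def)
  qed
  then have "scaling k N g = f" by (rule ext)
  show ?thesis
    by (rule exI[of _ f], rule exI[of _ g], rule exI[of _ C], intro conjI allI)
       (fact | rule g_def[symmetric] | rule close_f close_g)+
qed

end

section \<open>Relative entropy under a change of the reference measure\<close>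

text \<open>
  Multiplying the reference measure by \<open>exp \<phi>\<close> subtracts \<open>\<phi>\<close> from the logarithm of the density. The
  identity includes the value \<open>\<infinity>\<close>, as neither absolute continuity nor integrability is affected.
\<close>
lemma Ent_density_exp:
  fixes \<phi> :: "'a \<Rightarrow> real"
  assumes M: "sigma_finite_measure M" and P: "finite_measure P" and sets: "sets P = sets M"
    and \<phi>[measurable]: "\<phi> \<in> borel_measurable M" and int: "integrable P \<phi>"
  shows "Ent P (density M (\<lambda>x. ennreal (exp (\<phi> x)))) = Ent P M - ereal (\<integral>x. \<phi> x \<partial>P)"
proof -
  interpret M: sigma_finite_measure M by fact
  define N where "N = density M (\<lambda>x. ennreal (exp (\<phi> x)))"
  have sets_N[measurable_cong]: "sets N = sets M" by (simp add: N_def)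
  interpret N: sigma_finite_measure N
    unfolding N_def by (subst M.sigma_finite_iff_density_finite) auto
  note [measurable_cong] = sets
  have "density N (\<lambda>x. ennreal (exp (- \<phi> x))) = density M (\<lambda>x. 1)"
    unfolding N_def by (subst density_density_eq)
      (auto intro!: density_cong AE_I2 simp: ennreal_mult[symmetric] exp_minus)
  then have M_N: "M = density N (\<lambda>x. ennreal (exp (- \<phi> x)))" by (simp add: density_1)
  have MN: "absolutely_continuous M N" unfolding N_def by (rule absolutely_continuousI_density) measurable
  have NM: "absolutely_continuous N M" 
  proof -
    have "absolutely_continuous N (density N (\<lambda>x. ennreal (exp (- \<phi> x))))"
      by (rule absolutely_continuousI_density) measurable
    then show ?thesis by (simp only: M_N[symmetric])
  qed
  have ac_iff: "absolutely_continuous N P \<longleftrightarrow> absolutely_continuous M P"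
    using MN NM unfolding absolutely_continuous_def by blast
  show ?thesis
  proof (cases "absolutely_continuous M P")
    case True
    then obtain D where [measurable]: "D \<in> borel_measurable M"
      and D: "AE x in M. RN_deriv M P x = ennreal (D x)" "AE x in P. 0 < D x" "\<And>x. 0 \<le> D x"
      using M.real_RN_deriv[OF P True sets] by metis
    have "P = density M (RN_deriv M P)" using True sets by (simp add: M.density_RN_deriv)
    also have "\<dots> = density M (\<lambda>x. ennreal (D x))" using D(1) by (intro density_cong) auto
    also have "\<dots> = density N (\<lambda>x. ennreal (D x * exp (- \<phi> x)))"
      unfolding N_def using D(3) by (subst density_density_eq)
        (auto intro!: density_cong AE_I2 simp: ennreal_mult[symmetric] exp_minus)
    finally have "density N (\<lambda>x. ennreal (D x * exp (- \<phi> x))) = P" by simp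
    then have "AE x in N. ennreal (D x * exp (- \<phi> x)) = RN_deriv N P x"
      by (intro N.RN_deriv_unique) auto
    then have "AE x in P. ennreal (D x * exp (- \<phi> x)) = RN_deriv N P x"
      using True ac_iff sets by (intro absolutely_continuous_AE[of P N]) (auto simp: sets_N)
    moreover have "AE x in P. RN_deriv M P x = ennreal (D x)"
      using D(1) True sets by (intro absolutely_continuous_AE[of P M]) auto
    ultimately have AE: "AE x in P. entropy_density (exp 1) N P x = entropy_density (exp 1) M P x - \<phi> x"
      using D(2)
    proof eventually_elim
      case (elim x)
      then show ?case using D(3)[of x]
        by (simp add: entropy_density_def elim(1)[symmetric] log_def ln_mult)
    qed
    have [measurable]: "entropy_density (exp 1) M P \<in> borel_measurable P"
      "entropy_density (exp 1) N P \<in> borel_measurable P"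
      using measurable_entropy_density[of "exp 1" M P] measurable_entropy_density[of "exp 1" N P]
      by (simp_all add: measurable_cong_sets[OF sets refl] measurable_cong_sets[OF sets_N refl])
    have [measurable]: "\<phi> \<in> borel_measurable P" by measurable
    have "integrable P (entropy_density (exp 1) N P)
        \<longleftrightarrow> integrable P (\<lambda>x. entropy_density (exp 1) M P x - \<phi> x)"
      using AE by (intro integrable_cong_AE) auto
    also have "\<dots> \<longleftrightarrow> integrable P (entropy_density (exp 1) M P)"
      using int Bochner_Integration.integrable_add[of P "\<lambda>x. entropy_density (exp 1) M P x - \<phi> x" \<phi>]
      by auto
    finally have int_iff: "integrable P (entropy_density (exp 1) N P)
        \<longleftrightarrow> integrable P (entropy_density (exp 1) M P)" .
    show ?thesis
    proof (cases "integrable P (entropy_density (exp 1) M P)")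
      case i: True
      have "KL_divergence (exp 1) N P = (\<integral>x. entropy_density (exp 1) M P x - \<phi> x \<partial>P)"
        unfolding KL_divergence_def using AE by (intro integral_cong_AE) auto
      also have "\<dots> = KL_divergence (exp 1) M P - (\<integral>x. \<phi> x \<partial>P)"
        unfolding KL_divergence_def using i int by simp
      finally show ?thesis
        using True i int_iff ac_iff by (simp add: Ent_def N_def[symmetric])
    qed (use int_iff in \<open>simp add: Ent_def N_def[symmetric]\<close>)
  qed (use ac_iff in \<open>simp add: Ent_def N_def[symmetric]\<close>)
qed

lemma Ent_self: 
  assumes "prob_space M"
  shows "Ent M M = 0"
proof -
  interpret prob_space M by fact
  have "AE x in M. 1 = RN_deriv M M x"
    by (intro RN_deriv_unique) (auto simp: density_1)
  then have "AE x in M. entropy_density (exp 1) M M x = 0"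
    by eventually_elim (simp add: entropy_density_def flip: one_ennreal_def)
  then have "integrable M (entropy_density (exp 1) M M) \<longleftrightarrow> integrable M (\<lambda>x. 0 :: real)"
    by (intro integrable_cong_AE) auto
  then show ?thesis
    using KL_same_eq_0[of "exp 1"] by (simp add: Ent_def absolutely_continuous_def)
qed

lemma finite_Ent_density:
  assumes M: "sigma_finite_measure M" and P: "finite_measure P" and sets: "sets P = sets M"
    and fin: "Ent P M \<noteq> \<infinity>"
  obtains D where "D \<in> borel_measurable M" "\<And>x. 0 \<le> D x" "P = density M (\<lambda>x. ennreal (D x))"
    "integrable M (\<lambda>x. D x * ln (D x))" "Ent P M = ereal (KL_divergence (exp 1) M P)"
proof -
  interpret M: sigma_finite_measure M by fact
  note [measurable_cong] = sets
  have ac: "absolutely_continuous M P" and int: "integrable P (entropy_density (exp 1) M P)"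
    using fin by (auto simp: Ent_def split: if_splits)
  obtain D where D_meas[measurable]: "D \<in> borel_measurable M"
    and D: "AE x in M. RN_deriv M P x = ennreal (D x)" "AE x in P. 0 < D x" "\<And>x. 0 \<le> D x"
    using M.real_RN_deriv[OF P ac sets] by metis
  have "P = density M (RN_deriv M P)" using ac sets by (simp add: M.density_RN_deriv)
  also have "\<dots> = density M (\<lambda>x. ennreal (D x))" using D(1) by (intro density_cong) auto
  finally have P_eq: "P = density M (\<lambda>x. ennreal (D x))" .
  have "AE x in P. RN_deriv M P x = ennreal (D x)"
    using D(1) ac sets by (intro absolutely_continuous_AE[of P M]) auto
  then have AE: "AE x in P. entropy_density (exp 1) M P x = ln (D x)"
    by eventually_elim (simp add: entropy_density_def log_def D(3))
  have [measurable]: "entropy_density (exp 1) M P \<in> borel_measurable P"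
    using measurable_entropy_density[of "exp 1" M P] by (simp add: measurable_cong_sets[OF sets refl])
  have "integrable P (entropy_density (exp 1) M P) \<longleftrightarrow> integrable P (\<lambda>x. ln (D x))"
    using AE by (intro integrable_cong_AE) auto
  then have "integrable (density M (\<lambda>x. ennreal (D x))) (\<lambda>x. ln (D x))"
    using int P_eq by simp
  then have "integrable M (\<lambda>x. D x * ln (D x))"
    using D(3) by (subst (asm) integrable_density) auto
  then show ?thesis
    using that[OF D_meas D(3) P_eq] fin by (simp add: Ent_def split: if_splits)
qed

lemma Ent_nonneg:
  assumes M: "prob_space M" and P: "prob_space P" and sets: "sets P = sets M"
  shows "0 \<le> Ent P M"
proof (cases "Ent P M = \<infinity>")
  case False
  interpret M: prob_space M by fact
  interpret P: prob_space P by fact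
  interpret information_space M "exp 1" by unfold_locales simp
  obtain D where [measurable]: "D \<in> borel_measurable M" and D: "\<And>x. 0 \<le> D x" "P = density M (\<lambda>x. ennreal (D x))"
    "integrable M (\<lambda>x. D x * ln (D x))" "Ent P M = ereal (KL_divergence (exp 1) M P)"
    using finite_Ent_density[OF M.sigma_finite_measure_axioms P.finite_measure_axioms sets False] by metis
  have "0 \<le> KL_divergence (exp 1) M (density M (\<lambda>x. ennreal (D x)))"
    using D P by (intro KL_nonneg) (auto simp: log_def)
  then show ?thesis using D(2,4) by simp
qed simp

text \<open>
  Young's inequality \<open>D v \<le> D ln D + exp v\<close> for the pair of conjugate functions \<open>D ln D - D\<close> and \<open>exp\<close>.
\<close>
lemma integrable_if_exp_integrable:
  fixes v :: "'a \<Rightarrow> real"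
  assumes M: "sigma_finite_measure M" and P: "finite_measure P" and sets: "sets P = sets M"
    and fin: "Ent P M \<noteq> \<infinity>"
    and v[measurable]: "v \<in> borel_measurable M" "\<And>x. 0 \<le> v x" "integrable M (\<lambda>x. exp (v x))"
  shows "integrable P v"
proof -
  obtain D where [measurable]: "D \<in> borel_measurable M" and D: "\<And>x. 0 \<le> D x" "P = density M (\<lambda>x. ennreal (D x))"
    "integrable M (\<lambda>x. D x * ln (D x))"
    using finite_Ent_density[OF M P sets fin] by metis
  have young: "D x * v x \<le> D x * ln (D x) + exp (v x)" for x
  proof (cases "D x = 0")
    case False
    then have pos: "0 < D x" using D(1)[of x] by simp
    have "v x - ln (D x) \<le> exp (v x - ln (D x))"
      using exp_ge_add_one_self[of "v x - ln (D x)"] by linarith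
    then have "D x * (v x - ln (D x)) \<le> D x * exp (v x - ln (D x))" using pos by simp
    also have "\<dots> = exp (v x)" using pos by (simp add: exp_diff)
    finally show ?thesis by (simp add: algebra_simps)
  qed simp
  have "integrable M (\<lambda>x. D x * v x)"
  proof (rule Bochner_Integration.integrable_bound)
    show "integrable M (\<lambda>x. D x * ln (D x) + exp (v x))" using D(3) v(3) by simp
    show "AE x in M. norm (D x * v x) \<le> norm (D x * ln (D x) + exp (v x))"
    proof (rule AE_I2)
      fix x
      have "0 \<le> D x * v x" using D(1) v(2) by simp
      then show "norm (D x * v x) \<le> norm (D x * ln (D x) + exp (v x))" using young[of x] by simp
    qed
  qed measurable
  then show ?thesis unfolding D(2) using D(1) by (subst integrable_density) auto
qed

section \<open>The Schroedinger bridge\<close>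

context scaling_iteration
begin

definition bridge :: "('a \<Rightarrow> real) \<Rightarrow> ('b \<Rightarrow> real) \<Rightarrow> ('a \<times> 'b) measure" where
  "bridge f g = density (M \<Otimes>\<^sub>M N) (\<lambda>(x, y). ennreal (k x y * f x * g y))"

lemma sets_bridge[measurable_cong, simp]: "sets (bridge f g) = sets (M \<Otimes>\<^sub>M N)"
  by (simp add: bridge_def)

lemma sigma_finite_bridge:
  assumes f: "weight M f" and g: "weight N g"
  shows "sigma_finite_measure (bridge f g)"
proof -
  interpret MN: pair_sigma_finite M N ..
  note [measurable] = op.weight_measurable[OF f] weight_measurable[OF g]
  show ?thesis
    unfolding bridge_def by (subst MN.sigma_finite_iff_density_finite) auto
qed

text \<open>Each of the two fixed point equations says that one marginal is correct.\<close>
lemma bridge_in_couplings: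
  assumes f: "weight M f" and g: "weight N g"
    and fg: "scaling k N g = f" "scaling (\<lambda>y x. k x y) M f = g"
  shows "bridge f g \<in> couplings M N"
proof -
  interpret MN: pair_sigma_finite M N ..
  note [measurable] = op.weight_measurable[OF f] weight_measurable[OF g]
  note pos = op.weight_pos[OF f] weight_pos[OF g] k_pos
  have "distr (bridge f g) M fst = M"
  proof (rule measure_eqI)
    fix A assume "A \<in> sets (distr (bridge f g) M fst)"
    then have [measurable]: "A \<in> sets M" by simp
    have "emeasure (distr (bridge f g) M fst) A = (\<integral>\<^sup>+z. indicator A (fst z) \<partial>bridge f g)"
      by (subst nn_integral_indicator[symmetric]) (auto simp: nn_integral_distr simp del: nn_integral_indicator)
    also have "\<dots> = (\<integral>\<^sup>+z. ennreal (k (fst z) (snd z) * f (fst z) * g (snd z)) * indicator A (fst z) \<partial>(M \<Otimes>\<^sub>M N))"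
      unfolding bridge_def by (subst nn_integral_density) (auto simp: case_prod_unfold)
    also have "\<dots> = (\<integral>\<^sup>+x. \<integral>\<^sup>+y. ennreal (k x y * f x * g y) * indicator A x \<partial>N \<partial>M)"
      by (subst N.nn_integral_fst[symmetric]) auto
    also have "\<dots> = (\<integral>\<^sup>+x. indicator A x \<partial>M)"
    proof (intro nn_integral_cong)
      fix x
      have "(\<integral>\<^sup>+y. ennreal (k x y * f x * g y) * indicator A x \<partial>N)
          = (\<integral>\<^sup>+y. ennreal (f x) * ennreal (k x y * g y) \<partial>N) * indicator A x"
        using pos by (subst nn_integral_multc)
          (auto intro!: nn_integral_cong simp: ennreal_mult[symmetric] less_imp_le mult_ac)
      also have "\<dots> = ennreal (f x) * ennreal (1 / f x) * indicator A x"
        by (simp add: nn_integral_cmult nn_integral_kernel_weight[OF g] fg)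
      also have "\<dots> = indicator A x"
        using pos(1)[of x] by (simp add: ennreal_mult[symmetric] less_imp_le)
      finally show "(\<integral>\<^sup>+y. ennreal (k x y * f x * g y) * indicator A x \<partial>N) = indicator A x" .
    qed
    finally show "emeasure (distr (bridge f g) M fst) A = emeasure M A" by simp
  qed simp
  moreover have "distr (bridge f g) N snd = N"
  proof (rule measure_eqI)
    fix A assume "A \<in> sets (distr (bridge f g) N snd)"
    then have [measurable]: "A \<in> sets N" by simp
    have "emeasure (distr (bridge f g) N snd) A = (\<integral>\<^sup>+z. indicator A (snd z) \<partial>bridge f g)"
      by (subst nn_integral_indicator[symmetric]) (auto simp: nn_integral_distr simp del: nn_integral_indicator)
    also have "\<dots> = (\<integral>\<^sup>+z. ennreal (k (fst z) (snd z) * f (fst z) * g (snd z)) * indicator A (snd z) \<partial>(M \<Otimes>\<^sub>M N))"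
      unfolding bridge_def by (subst nn_integral_density) (auto simp: case_prod_unfold)
    also have "\<dots> = (\<integral>\<^sup>+y. \<integral>\<^sup>+x. ennreal (k x y * f x * g y) * indicator A y \<partial>M \<partial>N)"
      by (subst MN.nn_integral_snd[symmetric]) auto
    also have "\<dots> = (\<integral>\<^sup>+y. indicator A y \<partial>N)"
    proof (intro nn_integral_cong)
      fix y
      have "(\<integral>\<^sup>+x. ennreal (k x y * f x * g y) * indicator A y \<partial>M)
          = (\<integral>\<^sup>+x. ennreal (g y) * ennreal (k x y * f x) \<partial>M) * indicator A y"
        using pos by (subst nn_integral_multc)
          (auto intro!: nn_integral_cong simp: ennreal_mult[symmetric] less_imp_le mult_ac)
      also have "\<dots> = ennreal (g y) * ennreal (1 / g y) * indicator A y"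
        by (simp add: nn_integral_cmult op.nn_integral_kernel_weight[OF f] fg)
      also have "\<dots> = indicator A y"
        using pos(2)[of y] by (simp add: ennreal_mult[symmetric] less_imp_le)
      finally show "(\<integral>\<^sup>+x. ennreal (k x y * f x * g y) * indicator A y \<partial>M) = indicator A y" .
    qed
    finally show "emeasure (distr (bridge f g) N snd) A = emeasure N A" by simp
  qed simp
  moreover have "prob_space (bridge f g)"
    using calculation(1) M.prob_space_axioms by (intro prob_space_distrD[of fst "bridge f g" M]) auto
  ultimately show ?thesis by (simp add: couplings_def)
qed

lemma coupling_integral:
  assumes P: "P \<in> couplings M N" 
  shows "u \<in> borel_measurable M \<Longrightarrow> integrable P (\<lambda>z. u (fst z)) \<longleftrightarrow> integrable M (u :: 'a \<Rightarrow> real)"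
    and "w \<in> borel_measurable N \<Longrightarrow> integrable P (\<lambda>z. w (snd z)) \<longleftrightarrow> integrable N (w :: 'b \<Rightarrow> real)"
    and "u \<in> borel_measurable M \<Longrightarrow> (\<integral>z. u (fst z) \<partial>P) = (\<integral>x. u x \<partial>M)"
    and "w \<in> borel_measurable N \<Longrightarrow> (\<integral>z. w (snd z) \<partial>P) = (\<integral>y. w y \<partial>N)"
proof -
  have [measurable_cong]: "sets P = sets (M \<Otimes>\<^sub>M N)" and d: "distr P M fst = M" "distr P N snd = N"
    using P by (auto simp: couplings_def)
  show "u \<in> borel_measurable M \<Longrightarrow> integrable P (\<lambda>z. u (fst z)) \<longleftrightarrow> integrable M u"
    using integrable_distr_eq[of fst P M u] by (simp add: d)
  show "w \<in> borel_measurable N \<Longrightarrow> integrable P (\<lambda>z. w (snd z)) \<longleftrightarrow> integrable N w"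
    using integrable_distr_eq[of snd P N w] by (simp add: d)
  show "u \<in> borel_measurable M \<Longrightarrow> (\<integral>z. u (fst z) \<partial>P) = (\<integral>x. u x \<partial>M)"
    using integral_distr[of fst P M u] by (simp add: d)
  show "w \<in> borel_measurable N \<Longrightarrow> (\<integral>z. w (snd z) \<partial>P) = (\<integral>y. w y \<partial>N)"
    using integral_distr[of snd P N w] by (simp add: d)
qed

text \<open>
  The logarithm of the density between two bridges separates into a function of \<open>x\<close> and one of \<open>y\<close>, so
  its integral depends only on the marginals of \<open>P\<close>.
\<close>
lemma Ent_change_bridge:
  assumes f: "weight M f" "weight M f'" and g: "weight N g" "weight N g'"
    and P: "P \<in> couplings M N"
    and int: "integrable M (\<lambda>x. ln (f' x) - ln (f x))" "integrable N (\<lambda>y. ln (g' y) - ln (g y))"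
  shows "Ent P (bridge f' g') = Ent P (bridge f g)
    - ereal ((\<integral>x. ln (f' x) - ln (f x) \<partial>M) + (\<integral>y. ln (g' y) - ln (g y) \<partial>N))"
proof -
  note [measurable] = f[THEN op.weight_measurable] g[THEN weight_measurable]
  note pos = f[THEN op.weight_pos] g[THEN weight_pos] k_pos
  define \<phi> where "\<phi> z = (ln (f' (fst z)) - ln (f (fst z))) + (ln (g' (snd z)) - ln (g (snd z)))" for z
  have [measurable]: "\<phi> \<in> borel_measurable (M \<Otimes>\<^sub>M N)" unfolding \<phi>_def[abs_def] by measurable
  have "bridge f' g' = density (bridge f g) (\<lambda>z. ennreal (exp (\<phi> z)))"
    unfolding bridge_def using pos
    by (subst density_density_eq)
       (auto intro!: density_cong AE_I2 simp: \<phi>_def exp_add exp_diff ennreal_mult[symmetric] less_imp_le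
          less_imp_neq[symmetric] case_prod_unfold)
  moreover have "Ent P (density (bridge f g) (\<lambda>z. ennreal (exp (\<phi> z)))) = Ent P (bridge f g) - ereal (\<integral>z. \<phi> z \<partial>P)"
  proof (rule Ent_density_exp)
    show "integrable P \<phi>"
      unfolding \<phi>_def[abs_def] using int coupling_integral(1)[OF P, of "\<lambda>x. ln (f' x) - ln (f x)"]
        coupling_integral(2)[OF P, of "\<lambda>y. ln (g' y) - ln (g y)"]
      by (intro Bochner_Integration.integrable_add) auto
    show "finite_measure P" using P by (auto simp: couplings_def prob_space_def)
    show "sets P = sets (bridge f g)" using P by (simp add: couplings_def)
  qed (auto intro: sigma_finite_bridge f g)
  moreover have "(\<integral>z. \<phi> z \<partial>P) = (\<integral>x. ln (f' x) - ln (f x) \<partial>M) + (\<integral>y. ln (g' y) - ln (g y) \<partial>N)"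
    unfolding \<phi>_def using int coupling_integral(1,3)[OF P, of "\<lambda>x. ln (f' x) - ln (f x)"]
      coupling_integral(2,4)[OF P, of "\<lambda>y. ln (g' y) - ln (g y)"]
    by (subst Bochner_Integration.integral_add) auto
  ultimately show ?thesis by simp
qed

text \<open>
  In the application \<open>ln g\<^sub>0\<close> is the potential \<open>V\<close>, which may be unbounded; this is where the existence of
  a coupling of finite entropy enters. The positive part is dominated by \<open>g\<^sub>0\<close>. For the negative part
  \<open>v\<close>, the second marginal of the initial bridge has a density comparable to \<open>g\<^sub>0\<close>, against which \<open>exp v\<close>
  is integrable because \<open>exp v \<le> 1 + 1/g\<^sub>0\<close>.
\<close>
lemma ln_g\<^sub>0_integrable:
  assumes P: "P \<in> couplings M N" and fin: "Ent P (bridge (fs 0) (gs 0)) \<noteq> \<infinity>"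
  shows "integrable N (\<lambda>y. ln (g\<^sub>0 y))"
proof -
  have g0: "weight N g\<^sub>0" by (rule weight_g\<^sub>0)
  note [measurable] = weight_measurable[OF g0]
  note pos = weight_pos[OF g0]
  interpret MN: pair_prob_space M N ..
  interpret NM: pair_sigma_finite N M ..
  define v where "v y = max 0 (- ln (g\<^sub>0 y))" for y
  have [measurable]: "v \<in> borel_measurable N" unfolding v_def[abs_def] by measurable
  have exp_v: "exp (v y) * g\<^sub>0 y \<le> 1 + g\<^sub>0 y" for y
    using pos[of y] by (auto simp: v_def max_def exp_minus field_simps)
  have "integrable P (\<lambda>z. v (snd z))"
  proof (rule integrable_if_exp_integrable[OF sigma_finite_bridge[OF weight_fs weight_gs] _ _ fin])
    define B where "B = 1 / a * (1 / (a * (\<integral>y. g\<^sub>0 y \<partial>N)))"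
    have "integrable (M \<Otimes>\<^sub>M N) (\<lambda>z. (1 + g\<^sub>0 (snd z)))"
    proof -
      have "integrable (distr (N \<Otimes>\<^sub>M M) N fst) g\<^sub>0"
        using weight_integrable[OF g0] by (simp add: M.distr_pair_fst)
      then have "integrable (N \<Otimes>\<^sub>M M) (\<lambda>z. g\<^sub>0 (fst z))"
        by (subst (asm) integrable_distr_eq) auto
      from NM.integrable_product_swap[OF this] have "integrable (M \<Otimes>\<^sub>M N) (\<lambda>z. g\<^sub>0 (snd z))"
        by (simp add: case_prod_unfold)
      then show ?thesis by simp
    qed
    then have "integrable (M \<Otimes>\<^sub>M N) (\<lambda>z. B * (1 + g\<^sub>0 (snd z)))" by simp
    then have "integrable (M \<Otimes>\<^sub>M N) (\<lambda>z. (k (fst z) (snd z) * fs 0 (fst z) * gs 0 (snd z)) * exp (v (snd z)))"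
    proof (rule Bochner_Integration.integrable_bound)
      show "AE z in M \<Otimes>\<^sub>M N. norm (k (fst z) (snd z) * fs 0 (fst z) * gs 0 (snd z) * exp (v (snd z)))
          \<le> norm (B * (1 + g\<^sub>0 (snd z)))"
      proof (rule AE_I2)
        fix z :: "'a \<times> 'b"
        obtain x y where z: "z = (x, y)" by force
        have kf: "k x y * fs 0 x \<le> B"
          unfolding B_def using k_bounds(2)[of x y] scaling_le[OF g0, of x] k_pos[of x y] fs_pos[of 0 x] a
          by (intro mult_mono) (auto simp: fs_def less_imp_le)
        then have "(k x y * fs 0 x) * (exp (v y) * g\<^sub>0 y) \<le> B * (1 + g\<^sub>0 y)"
          using exp_v[of y] k_pos[of x y] fs_pos[of 0 x] pos[of y]
          by (intro mult_mono) (auto simp: less_imp_le intro: order_trans[OF _ kf])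
        moreover have "0 \<le> (k x y * fs 0 x) * (exp (v y) * g\<^sub>0 y)"
          using k_pos[of x y] fs_pos[of 0 x] pos[of y] by simp
        ultimately show "norm (k (fst z) (snd z) * fs 0 (fst z) * gs 0 (snd z) * exp (v (snd z)))
            \<le> norm (B * (1 + g\<^sub>0 (snd z)))"
          by (simp add: z mult_ac)
      qed
    qed measurable
    then show "integrable (bridge (fs 0) (gs 0)) (\<lambda>z. exp (v (snd z)))"
      unfolding bridge_def case_prod_unfold using k_pos fs_pos[of 0] gs_pos[of 0]
      by (subst integrable_density) (auto intro!: AE_I2 simp: less_imp_le)
    show "sets P = sets (bridge (fs 0) (gs 0))" using P by (simp add: couplings_def)
    show "finite_measure P" using P by (auto simp: couplings_def prob_space_def)
    show "(\<lambda>z. v (snd z)) \<in> borel_measurable (bridge (fs 0) (gs 0))" by measurable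
  qed (simp add: v_def)
  then have "integrable N v" by (subst (asm) coupling_integral(2)[OF P]) auto
  then have "integrable N (\<lambda>y. v y + g\<^sub>0 y)" using weight_integrable[OF g0] by simp
  then show ?thesis
  proof (rule Bochner_Integration.integrable_bound)
    show "AE y in N. norm (ln (g\<^sub>0 y)) \<le> norm (v y + g\<^sub>0 y)"
    proof (rule AE_I2)
      fix y
      have "ln (g\<^sub>0 y) \<le> g\<^sub>0 y" using ln_le_minus_one[OF pos[of y]] by linarith
      then show "norm (ln (g\<^sub>0 y)) \<le> norm (v y + g\<^sub>0 y)" using pos[of y] by (auto simp: v_def)
    qed
  qed measurable
qed

text \<open>
  The bridge of the fixed point is the coupling closest to itself, and by \<open>Ent_change_bridge\<close> the entropies
  relative to it and to the initial bridge differ by the same constant for all couplings. So both have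
  the same minimizers, and any of them has entropy at most zero relative to the limit.
\<close>
lemma schroedinger_bridge_entropy_decay:
  assumes ex: "\<exists>P\<in>couplings M N. Ent P (bridge (fs 0) (gs 0)) < \<infinity>"
  shows "\<exists>c>0. \<forall>n. Ent (arg_min_on (\<lambda>P. Ent P (bridge (fs 0) (gs 0))) (couplings M N)) (bridge (fs n) (gs n))
    \<le> ereal (c * rate ^ n)"
proof -
  define SB where "SB = arg_min_on (\<lambda>P. Ent P (bridge (fs 0) (gs 0))) (couplings M N)"
  have ln_g0: "integrable N (\<lambda>y. ln (g\<^sub>0 y))" using ex ln_g\<^sub>0_integrable by auto
  obtain f g C where f: "weight M f" and g: "weight N g"
    and fg: "scaling k N g = f" "scaling (\<lambda>y x. k x y) M f = g" and C: "0 < C"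
    and close: "\<forall>n x. \<bar>ln (fs n x) - ln (f x)\<bar> \<le> C * rate ^ n" "\<forall>n y. \<bar>ln (gs (Suc n) y) - ln (g y)\<bar> \<le> C * rate ^ n"
    using scaling_limit by blast
  note [measurable] = op.weight_measurable[OF f] weight_measurable[OF g]
  have int_f: "integrable M (\<lambda>x. ln (fs n x) - ln (f x))" for n
    using close by (intro M.integrable_const_bound[where B="C * rate ^ n"]) auto
  have int_gS: "integrable N (\<lambda>y. ln (gs (Suc n) y) - ln (g y))" for n
    using close by (intro N.integrable_const_bound[where B="C * rate ^ n"]) auto
  have int_g: "integrable N (\<lambda>y. ln (gs n y) - ln (g y))" for n
  proof (cases n)
    case 0
    define F where "F = (\<integral>x. f x \<partial>M)"
    have F: "0 < F" unfolding F_def by (rule op.weight_integral_pos[OF f])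
    have "a / F \<le> g y" "g y \<le> 1 / (a * F)" for y
      using op.scaling_ge[OF f, of y] op.scaling_le[OF f, of y] by (auto simp: fg F_def)
    then have "ln (a / F) \<le> ln (g y)" "ln (g y) \<le> ln (1 / (a * F))" for y
      using a F weight_pos[OF g] by (auto simp: ln_le_cancel_iff simp del: ln_div ln_mult)
    then have "\<bar>ln (g y)\<bar> \<le> \<bar>ln (a / F)\<bar> + \<bar>ln (1 / (a * F))\<bar>" for y
      by (smt (verit))
    then have "integrable N (\<lambda>y. ln (g y))"
      by (intro N.integrable_const_bound[where B="\<bar>ln (a / F)\<bar> + \<bar>ln (1 / (a * F))\<bar>"]) auto
    then show ?thesis using ln_g0 by (simp add: 0)
  qed (use int_gS in simp)
  define c where "c n = (\<integral>x. ln (fs n x) - ln (f x) \<partial>M) + (\<integral>y. ln (gs n y) - ln (g y) \<partial>N)" for n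
  have pythagoras: "Ent P (bridge (fs n) (gs n)) = Ent P (bridge f g) - ereal (c n)" if "P \<in> couplings M N" for P n
    unfolding c_def by (rule Ent_change_bridge[OF f weight_fs g weight_gs that int_f int_g])
  have opt: "bridge f g \<in> couplings M N" by (rule bridge_in_couplings[OF f g fg])
  then have prob: "prob_space (bridge f g)" by (simp add: couplings_def)
  have opt0: "Ent (bridge f g) (bridge f g) = 0" by (rule Ent_self[OF prob])
  have "is_arg_min (\<lambda>P. Ent P (bridge (fs 0) (gs 0))) (\<lambda>P. P \<in> couplings M N) (bridge f g)"
    unfolding is_arg_min_linorder
  proof (intro conjI allI impI opt)
    fix P assume P: "P \<in> couplings M N"
    then have "0 \<le> Ent P (bridge f g)" by (intro Ent_nonneg prob) (auto simp: couplings_def)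
    then show "Ent (bridge f g) (bridge (fs 0) (gs 0)) \<le> Ent P (bridge (fs 0) (gs 0))"
      unfolding pythagoras[OF P] pythagoras[OF opt] opt0 by (intro ereal_minus_mono) auto
  qed
  then have "is_arg_min (\<lambda>P. Ent P (bridge (fs 0) (gs 0))) (\<lambda>P. P \<in> couplings M N) SB"
    unfolding SB_def arg_min_on_def arg_min_def by (rule someI)
  then have SB: "SB \<in> couplings M N" and "Ent SB (bridge (fs 0) (gs 0)) \<le> Ent (bridge f g) (bridge (fs 0) (gs 0))"
    using opt by (auto simp: is_arg_min_linorder)
  then have SB_le: "Ent SB (bridge f g) \<le> 0"
    unfolding pythagoras[OF SB] pythagoras[OF opt] opt0 by (cases "Ent SB (bridge f g)") auto
  have Ent_le: "Ent SB (bridge (fs n) (gs n)) \<le> ereal \<bar>c n\<bar>" for n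
  proof -
    have "Ent SB (bridge (fs n) (gs n)) \<le> 0 - ereal (c n)"
      unfolding pythagoras[OF SB] using SB_le by (intro ereal_minus_mono) auto
    also have "\<dots> \<le> ereal \<bar>c n\<bar>" by simp
    finally show ?thesis .
  qed
  have c_Suc: "\<bar>c (Suc n)\<bar> \<le> 2 * C / rate * rate ^ Suc n" for n
  proof -
    have "\<bar>\<integral>x. ln (fs (Suc n) x) - ln (f x) \<partial>M\<bar> \<le> (\<integral>x. C * rate ^ Suc n \<partial>M)"
      using close int_f[of "Suc n"]
      by (intro order_trans[OF integral_abs_bound] integral_mono) (auto simp del: power_Suc)
    moreover have "C * rate ^ Suc n \<le> C * rate ^ n"
      using C rate by (intro mult_left_mono power_decreasing) auto
    moreover have "\<bar>\<integral>y. ln (gs (Suc n) y) - ln (g y) \<partial>N\<bar> \<le> (\<integral>y. C * rate ^ n \<partial>N)"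
      using close int_gS[of n] by (intro order_trans[OF integral_abs_bound] integral_mono) auto
    ultimately have "\<bar>c (Suc n)\<bar> \<le> 2 * (C * rate ^ n)" 
      unfolding c_def by (simp add: M.prob_space N.prob_space)
    then show ?thesis using rate by simp
  qed
  \<comment> \<open>At \<open>n = 0\<close> the weight \<open>g\<^sub>0\<close> is arbitrary, so its contribution enters the constant.\<close>
  define c' where "c' = 2 * C / rate + \<bar>c 0\<bar>"
  have c': "0 < c'" using C rate by (simp add: c'_def add_pos_nonneg)
  have "\<bar>c n\<bar> \<le> c' * rate ^ n" for n
  proof (cases n)
    case 0
    then show ?thesis using C rate by (simp add: c'_def)
  next
    case (Suc m)
    have "2 * C / rate * rate ^ n \<le> c' * rate ^ n"
      using rate by (intro mult_right_mono) (auto simp: c'_def)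
    then show ?thesis using c_Suc[of m] Suc by simp
  qed
  then have "Ent SB (bridge (fs n) (gs n)) \<le> ereal (c' * rate ^ n)" for n
    using order_trans[OF Ent_le[of n]] by simp
  then show ?thesis using c' unfolding SB_def by auto
qed

end

section \<open>Decay of the marginals\<close>

context scaling_iteration
begin

text \<open>Marginals of the even (on \<open>N\<close>) and odd (on \<open>M\<close>) Sinkhorn transitions, by their densities.\<close>
definition pi_N :: "nat \<Rightarrow> 'b measure" where
  "pi_N n = density N (\<lambda>y. ennreal (gs n y / gs (Suc n) y))"

definition pi_M :: "nat \<Rightarrow> 'a measure" where
  "pi_M n = density M (\<lambda>x. ennreal (fs n x / fs (Suc n) x))"

lemma ratio_pos: "0 < gs n y / gs (Suc n) y" "0 < fs n x / fs (Suc n) x"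
  using gs_pos fs_pos by auto

lemma prob_space_pi_N: "prob_space (pi_N n)"
  using nn_integral_ratio_scaling_scaling[OF weight_gs[of n]]
  unfolding pi_N_def fs_def[symmetric] gs_Suc[symmetric]
  by (intro prob_spaceI) (simp add: emeasure_density cong: nn_integral_cong)

lemma Phi_entropy_pi:
  assumes "entropy_function \<Phi>"
  shows "Phi_entropy \<Phi> (pi_N n) N = entropy_N \<Phi> n"
    and "Phi_entropy \<Phi> (pi_M n) M = entropy_M \<Phi> n"
  unfolding pi_N_def pi_M_def entropy_N_def entropy_M_def
  using ratio_pos
  by (auto intro!: Phi_entropy_density[OF assms] N.sigma_finite_measure_axioms M.sigma_finite_measure_axioms)

lemma Phi_entropy_pi_decay:
  assumes \<Phi>: "entropy_function \<Phi>"
  shows "Phi_entropy \<Phi> (pi_N n) N \<le> ereal (rate ^ n) * Phi_entropy \<Phi> (pi_N 0) N"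
    and "Phi_entropy \<Phi> N (pi_N n) \<le> ereal (rate ^ n) * Phi_entropy \<Phi> N (pi_N 0)"
    and "Phi_entropy \<Phi> (pi_M n) M \<le> ereal (rate ^ n) * Phi_entropy \<Phi> (pi_M 0) M"
    and "Phi_entropy \<Phi> M (pi_M n) \<le> ereal (rate ^ n) * Phi_entropy \<Phi> M (pi_M 0)"
  using entropy_decay[OF \<Phi>] entropy_decay[OF entropy_function_swap[OF \<Phi>]]
  by (simp_all add: Phi_entropy_swap[of \<Phi> N] Phi_entropy_swap[of \<Phi> M]
      Phi_entropy_pi[OF \<Phi>] Phi_entropy_pi[OF entropy_function_swap[OF \<Phi>]])

text \<open>
  Since \<open>g\<^sub>0\<close> need not be bounded, the even estimate has a geometric bound only from the first iteration
  on; at \<open>n = 0\<close> a finite norm is absorbed into the constant.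
\<close>
lemma log_deriv_norm_pi_decay:
  "\<exists>c>0. \<forall>n.
    (n \<ge> 1 \<or> log_deriv_norm (pi_N 0) N < \<infinity> \<longrightarrow> log_deriv_norm (pi_N n) N \<le> ereal (c * rate ^ n)) \<and>
    (n \<ge> 1 \<or> log_deriv_norm N (pi_N 0) < \<infinity> \<longrightarrow> log_deriv_norm N (pi_N n) \<le> ereal (c * rate ^ n)) \<and>
    log_deriv_norm (pi_M n) M \<le> ereal (c * rate ^ n)"
proof -
  obtain f g C where C: "0 < C"
    and close: "\<forall>n x. \<bar>ln (fs n x) - ln (f x)\<bar> \<le> C * rate ^ n" "\<forall>n y. \<bar>ln (gs (Suc n) y) - ln (g y)\<bar> \<le> C * rate ^ n"
    using scaling_limit by blast
  \<comment> \<open>Dividing by the rate compensates the shift between \<open>g\<^sub>n\<^sub>+\<^sub>1\<close> and the exponent \<open>n\<close> in its estimate.\<close>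
  define c0 where "c0 = 2 * C / rate"
  have c0: "2 * C \<le> c0" "0 < c0" using C rate by (auto simp: c0_def field_simps)
  have dec: "rate ^ Suc n \<le> rate ^ n" for n using rate by (intro power_decreasing) auto
  have M_bound: "\<bar>ln (fs n x / fs (Suc n) x)\<bar> \<le> 2 * C * rate ^ n" for n x
  proof -
    have "\<bar>ln (fs n x) - ln (f x)\<bar> \<le> C * rate ^ n" "\<bar>ln (fs (Suc n) x) - ln (f x)\<bar> \<le> C * rate ^ Suc n"
      using close(1) by blast+
    moreover have "C * rate ^ Suc n \<le> C * rate ^ n" using dec C by (intro mult_left_mono) auto
    moreover have "ln (fs n x / fs (Suc n) x) = ln (fs n x) - ln (fs (Suc n) x)"
      using fs_pos by (intro ln_divide_pos) auto
    ultimately show ?thesis by linarith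
  qed
  have N_bound: "\<bar>ln (gs (Suc n) y / gs (Suc (Suc n)) y)\<bar> \<le> c0 * rate ^ Suc n" for n y
  proof -
    have "\<bar>ln (gs (Suc n) y) - ln (g y)\<bar> \<le> C * rate ^ n" "\<bar>ln (gs (Suc (Suc n)) y) - ln (g y)\<bar> \<le> C * rate ^ Suc n"
      using close(2) by blast+
    moreover have "C * rate ^ Suc n \<le> C * rate ^ n" using dec C by (intro mult_left_mono) auto
    moreover have "ln (gs (Suc n) y / gs (Suc (Suc n)) y) = ln (gs (Suc n) y) - ln (gs (Suc (Suc n)) y)"
      using gs_pos by (intro ln_divide_pos) auto
    moreover have "c0 * rate ^ Suc n = 2 * (C * rate ^ n)" using rate by (simp add: c0_def)
    ultimately show ?thesis by linarith
  qed
  have start: "\<exists>b. L < \<infinity> \<longrightarrow> L \<le> ereal b" for L :: ereal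
    by (cases L) auto
  obtain b1 where b1: "log_deriv_norm (pi_N 0) N < \<infinity> \<longrightarrow> log_deriv_norm (pi_N 0) N \<le> ereal b1"
    using start by blast
  obtain b2 where b2: "log_deriv_norm N (pi_N 0) < \<infinity> \<longrightarrow> log_deriv_norm N (pi_N 0) \<le> ereal b2"
    using start by blast
  define c where "c = c0 + \<bar>b1\<bar> + \<bar>b2\<bar>"
  have c: "0 < c" "c0 \<le> c" "2 * C \<le> c" "b1 \<le> c" "b2 \<le> c" using c0 by (auto simp: c_def)
  have scale: "x \<le> z * rate ^ n \<Longrightarrow> z \<le> c \<Longrightarrow> x \<le> c * rate ^ n" for x z n
    using mult_right_mono[of z c "rate ^ n"] rate by (meson less_imp_le order_trans zero_le_power)
  have "log_deriv_norm (pi_M n) M \<le> ereal (c * rate ^ n)" for n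
    unfolding pi_M_def using ratio_pos scale[OF M_bound c(3)]
    by (intro log_deriv_norm_density_le M.sigma_finite_measure_axioms) auto
  moreover have "log_deriv_norm (pi_N n) N \<le> ereal (c * rate ^ n)"
    if "n \<ge> 1 \<or> log_deriv_norm (pi_N 0) N < \<infinity>" for n
  proof (cases n)
    case 0
    then show ?thesis using that b1 c(4) by (auto intro: order_trans)
  next
    case (Suc m)
    show ?thesis unfolding pi_N_def Suc using ratio_pos scale[OF N_bound c(2)]
      by (intro log_deriv_norm_density_le N.sigma_finite_measure_axioms) (auto simp del: power_Suc)
  qed
  moreover have "log_deriv_norm N (pi_N n) \<le> ereal (c * rate ^ n)"
    if "n \<ge> 1 \<or> log_deriv_norm N (pi_N 0) < \<infinity>" for n
  proof (cases n)
    case 0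
    then show ?thesis using that b2 c(5) by (auto intro: order_trans)
  next
    case (Suc m)
    show ?thesis
      using prob_space_pi_N[of n] unfolding pi_N_def Suc using ratio_pos scale[OF N_bound c(2)]
      by (intro log_deriv_norm_density_le') (auto simp del: power_Suc)
  qed
  ultimately show ?thesis using c(1) by blast
qed

end

section \<open>The Sinkhorn iterates as iterated half-steps\<close>

text \<open>
  The mass that \<open>M(dx) k(x,y) f(x) g(y) N(dy)\<close> puts at \<open>y\<close> is \<open>g(y)\<close> times \<open>\<integral>k(x,y) f(x) M(dx)\<close>, and the
  latter is the inverse of the next half-step.
\<close>
lemma (in bounded_kernel) bind_transition:
  assumes g: "weight N g"
  shows "M \<bind> (\<lambda>x. density N (\<lambda>y. ennreal (k x y * scaling k N g x * g y)))
    = density N (\<lambda>y. ennreal (g y / scaling (\<lambda>y x. k x y) M (scaling k N g) y))"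
proof -
  interpret op: bounded_kernel N M "\<lambda>y x. k x y" a by (rule swap)
  interpret MN: pair_sigma_finite M N ..
  define f where "f = scaling k N g"
  have f: "weight M f" unfolding f_def by (rule weight_scaling[OF g])
  note [measurable] = op.weight_measurable[OF f] weight_measurable[OF g] op.scaling_measurable[OF f]
  note pos = op.weight_pos[OF f] weight_pos[OF g] op.scaling_pos[OF f] k_pos
  define S where "S x = density N (\<lambda>y. ennreal (k x y * f x * g y))" for x
  have emeasure_S: "emeasure (S x) A = (\<integral>\<^sup>+y. ennreal (k x y * f x * g y) * indicator A y \<partial>N)" if "A \<in> sets N" for x A
    unfolding S_def using that by (subst emeasure_density) auto
  have [measurable]: "S \<in> measurable M (subprob_algebra N)"
  proof (rule measurable_subprob_algebra)
    fix x
    have "(\<integral>\<^sup>+y. ennreal (k x y * f x * g y) \<partial>N) = (\<integral>\<^sup>+y. ennreal (f x) * ennreal (k x y * g y) \<partial>N)"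
      using pos by (intro nn_integral_cong) (auto simp: ennreal_mult[symmetric] less_imp_le mult_ac)
    also have "\<dots> = ennreal (f x) * ennreal (1 / f x)"
      by (simp add: nn_integral_cmult nn_integral_kernel_weight[OF g] f_def)
    also have "\<dots> = 1" using pos(1)[of x] by (simp add: ennreal_mult[symmetric] less_imp_le)
    finally have "emeasure (S x) (space (S x)) = 1"
      by (simp add: S_def emeasure_density cong: nn_integral_cong)
    then show "subprob_space (S x)" by (intro prob_space_imp_subprob_space prob_spaceI)
    show "sets (S x) = sets N" by (simp add: S_def)
  next
    fix A assume [measurable]: "A \<in> sets N"
    show "(\<lambda>x. emeasure (S x) A) \<in> borel_measurable M"
      by (subst emeasure_S) measurable
  qed
  have "M \<bind> S = density N (\<lambda>y. ennreal (g y / scaling (\<lambda>y x. k x y) M f y))"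
  proof (rule measure_eqI)
    show "sets (M \<bind> S) = sets (density N (\<lambda>y. ennreal (g y / scaling (\<lambda>y x. k x y) M f y)))"
      by (simp add: S_def space_M)
    fix A assume "A \<in> sets (M \<bind> S)"
    then have [measurable]: "A \<in> sets N" by (simp add: S_def space_M)
    have "emeasure (M \<bind> S) A = (\<integral>\<^sup>+x. \<integral>\<^sup>+y. ennreal (k x y * f x * g y) * indicator A y \<partial>N \<partial>M)"
      by (subst emeasure_bind[where N=N]) (auto simp: space_M emeasure_S)
    also have "\<dots> = (\<integral>\<^sup>+y. \<integral>\<^sup>+x. ennreal (k x y * f x * g y) * indicator A y \<partial>M \<partial>N)"
      by (rule MN.Fubini'[symmetric]) measurable
    also have "\<dots> = (\<integral>\<^sup>+y. ennreal (g y / scaling (\<lambda>y x. k x y) M f y) * indicator A y \<partial>N)"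
    proof (intro nn_integral_cong)
      fix y
      have "(\<integral>\<^sup>+x. ennreal (k x y * f x * g y) * indicator A y \<partial>M)
          = (\<integral>\<^sup>+x. ennreal (g y) * ennreal (k x y * f x) \<partial>M) * indicator A y"
        using pos by (subst nn_integral_multc)
          (auto intro!: nn_integral_cong simp: ennreal_mult[symmetric] less_imp_le mult_ac)
      also have "\<dots> = ennreal (g y) * ennreal (1 / scaling (\<lambda>y x. k x y) M f y) * indicator A y"
        by (simp add: nn_integral_cmult op.nn_integral_kernel_weight[OF f])
      finally show "(\<integral>\<^sup>+x. ennreal (k x y * f x * g y) * indicator A y \<partial>M)
          = ennreal (g y / scaling (\<lambda>y x. k x y) M f y) * indicator A y"
        using pos by (simp add: ennreal_mult[symmetric] less_imp_le)
    qed
    also have "\<dots> = emeasure (density N (\<lambda>y. ennreal (g y / scaling (\<lambda>y x. k x y) M f y))) A"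
      by (subst emeasure_density) auto
    finally show "emeasure (M \<bind> S) A = \<dots>" .
  qed
  then show ?thesis by (simp add: S_def[abs_def] f_def)
qed

lemma integral_tilt:
  fixes F :: "'a \<Rightarrow> real"
  assumes "U \<in> borel_measurable M" "F \<in> borel_measurable M"
  shows "(\<integral>x. F x \<partial>tilt M U) = (\<integral>x. exp (- U x) * F x \<partial>M)"
  unfolding tilt_def using assms by (subst integral_density) auto

text \<open>
  The potentials enter the iteration only through \<open>exp (- U)\<close>, \<open>exp (- V)\<close> and \<open>exp (- W)\<close>; the first two
  are absorbed into the measures, and the initial potential \<open>V\<^sub>0 = 0\<close> becomes the weight \<open>exp V\<close>.
\<close>
locale bounded_sinkhorn_problem =
  fixes \<Lambda> :: "'a measure" and \<nu> :: "'b measure"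
    and U :: "'a \<Rightarrow> real" and V :: "'b \<Rightarrow> real" and W :: "'a \<Rightarrow> 'b \<Rightarrow> real" and w :: real
  assumes space_\<Lambda>: "space \<Lambda> = UNIV" and space_\<nu>: "space \<nu> = UNIV"
    and U[measurable]: "U \<in> borel_measurable \<Lambda>" and V[measurable]: "V \<in> borel_measurable \<nu>"
    and W[measurable]: "(\<lambda>(x, y). W x y) \<in> borel_measurable (\<Lambda> \<Otimes>\<^sub>M \<nu>)"
    and prob_U: "prob_space (tilt \<Lambda> U)" and prob_V: "prob_space (tilt \<nu> V)"
    and prob_Q: "\<And>x. prob_space (kernel_Q \<nu> W x)"
    and w: "0 < w" and W_bound: "\<And>x y. \<bar>W x y\<bar> \<le> w"
begin

lemma W_section[measurable]: "(\<lambda>y. W x y) \<in> borel_measurable \<nu>" "(\<lambda>x. W x y) \<in> borel_measurable \<Lambda>"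
  using measurable_compose[OF measurable_Pair1'[of x \<Lambda> \<nu>] W] measurable_compose[OF measurable_Pair2'[of y \<nu> \<Lambda>] W]
  by (simp_all add: space_\<Lambda> space_\<nu>)

lemma sets_tilt[measurable_cong, simp]: "sets (tilt M F) = sets M"
  by (simp add: tilt_def)

text \<open>The Markov kernel \<open>Q(x,\<cdot>)\<close> has a density with respect to \<open>\<nu>\<close> that is bounded below.\<close>
lemma finite_\<nu>: "finite_measure \<nu>"
proof (rule finite_measureI)
  interpret Q: prob_space "kernel_Q \<nu> W undefined" by (rule prob_Q)
  have "ennreal (exp (- w)) * emeasure \<nu> (space \<nu>) = (\<integral>\<^sup>+y. ennreal (exp (- w)) \<partial>\<nu>)" by simp
  also have "\<dots> \<le> (\<integral>\<^sup>+y. ennreal (exp (- W undefined y)) \<partial>\<nu>)"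
  proof (intro nn_integral_mono ennreal_leI)
    fix y show "exp (- w) \<le> exp (- W undefined y)" using W_bound[of undefined y] by simp
  qed
  also have "\<dots> = emeasure (kernel_Q \<nu> W undefined) (space (kernel_Q \<nu> W undefined))"
    by (simp add: kernel_Q_def tilt_def emeasure_density cong: nn_integral_cong)
  finally have "ennreal (exp (- w)) * emeasure \<nu> (space \<nu>) \<le> 1" by (simp add: Q.emeasure_space_1)
  then show "emeasure \<nu> (space \<nu>) \<noteq> \<infinity>" by (auto simp: ennreal_mult_top top_unique)
qed

sublocale it: scaling_iteration "tilt \<Lambda> U" "tilt \<nu> V" "\<lambda>x y. exp (- W x y)" "exp (- w)" "\<lambda>y. exp (V y)"
proof (intro scaling_iteration.intro bounded_kernel.intro prob_U prob_V bounded_kernel_axioms.intro scaling_iteration_axioms.intro)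
  show "(\<lambda>(x, y). exp (- W x y)) \<in> borel_measurable (tilt \<Lambda> U \<Otimes>\<^sub>M tilt \<nu> V)" by measurable
  show "space (tilt \<Lambda> U) = UNIV" "space (tilt \<nu> V) = UNIV"
    using space_\<Lambda> space_\<nu> by (auto simp: tilt_def)
  show "0 < exp (- w)" "exp (- w) < 1" using w by auto
  show "exp (- w) \<le> exp (- W x y)" for x y using W_bound[of x y] by simp
  show "exp (- W x y) \<le> 1 / exp (- w)" for x y
  proof -
    have "1 / exp (- w) = exp w" by (simp add: exp_minus field_simps)
    then show ?thesis using W_bound[of x y] by simp
  qed
  interpret finite_measure \<nu> by (rule finite_\<nu>)
  have "integrable (tilt \<nu> V) (\<lambda>y. exp (V y))"
    unfolding tilt_def by (subst integrable_density) (auto simp: exp_minus)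
  then show "weight (tilt \<nu> V) (\<lambda>y. exp (V y))" by (simp add: weight_def)
qed

text \<open>
  Names for the iterates that hide their dependence on \<open>U\<close>, \<open>V\<close> and \<open>W\<close>, so that rewriting of the
  exponentials does not reach into it.
\<close>
definition f_iter :: "nat \<Rightarrow> 'a \<Rightarrow> real" where "f_iter = it.fs"
definition g_iter :: "nat \<Rightarrow> 'b \<Rightarrow> real" where "g_iter = it.gs"

lemma iter_pos: "0 < f_iter n x" "0 < g_iter n y"
  by (simp_all add: f_iter_def g_iter_def it.fs_pos it.gs_pos)

lemma iter_nonzero[simp]: "f_iter n x \<noteq> 0" "g_iter n y \<noteq> 0"
  using iter_pos by (simp_all add: less_imp_neq[symmetric])

lemma g_iter_0: "g_iter 0 y = exp (V y)"
  by (simp add: g_iter_def)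

lemma measurable_iter[measurable]: "f_iter n \<in> borel_measurable \<Lambda>" "g_iter n \<in> borel_measurable \<nu>"
  using it.fs_measurable[of n] it.gs_measurable[of n] by (simp_all add: f_iter_def g_iter_def)

lemma kernel_apply_Q:
  "kernel_apply (kernel_Q \<nu> W) (\<lambda>y. exp (- (V y - ln (g_iter n y)))) x = 1 / f_iter n x"
proof -
  have "kernel_apply (kernel_Q \<nu> W) (\<lambda>y. exp (- (V y - ln (g_iter n y)))) x
      = (\<integral>y. exp (- V y) * (exp (- W x y) * g_iter n y) \<partial>\<nu>)"
    unfolding kernel_apply_def kernel_Q_def
    using iter_pos by (subst integral_tilt) (auto simp: exp_diff exp_minus field_simps)
  also have "\<dots> = (\<integral>y. exp (- W x y) * g_iter n y \<partial>tilt \<nu> V)" by (subst integral_tilt) auto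
  finally show ?thesis by (simp add: f_iter_def g_iter_def it.fs_def scaling_def)
qed

lemma kernel_apply_R:
  "kernel_apply (kernel_R \<Lambda> W) (\<lambda>x. exp (- (U x - ln (f_iter n x)))) y = 1 / g_iter (Suc n) y"
proof -
  have "kernel_apply (kernel_R \<Lambda> W) (\<lambda>x. exp (- (U x - ln (f_iter n x)))) y
      = (\<integral>x. exp (- U x) * (exp (- W x y) * f_iter n x) \<partial>\<Lambda>)"
    unfolding kernel_apply_def kernel_R_def
    using iter_pos by (subst integral_tilt) (auto simp: exp_diff exp_minus field_simps)
  also have "\<dots> = (\<integral>x. exp (- W x y) * f_iter n x \<partial>tilt \<Lambda> U)" by (subst integral_tilt) auto
  finally show ?thesis by (simp add: f_iter_def g_iter_def it.gs_Suc scaling_def)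
qed

text \<open>This is the Markov property of \<open>Q\<close>, and it accounts for \<open>U\<^sub>0 = U\<close>.\<close>
lemma f_iter_0: "f_iter 0 x = 1"
proof -
  interpret Q: prob_space "kernel_Q \<nu> W x" by (rule prob_Q)
  show ?thesis
    using kernel_apply_Q[of 0 x] Q.prob_space by (simp add: kernel_apply_def g_iter_0)
qed

lemma sinkhorn_potentials_eq:
  "sinkhorn_potentials \<Lambda> \<nu> U V W (2 * n) = (\<lambda>x. U x - ln (f_iter n x), \<lambda>y. V y - ln (g_iter n y))"
  "sinkhorn_potentials \<Lambda> \<nu> U V W (2 * n + 1) = (\<lambda>x. U x - ln (f_iter n x), \<lambda>y. V y - ln (g_iter (Suc n) y))"
proof (induction n)
  case 0
  show 1: "sinkhorn_potentials \<Lambda> \<nu> U V W (2 * 0) = (\<lambda>x. U x - ln (f_iter 0 x), \<lambda>y. V y - ln (g_iter 0 y))"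
    by (simp add: f_iter_0 g_iter_0)
  show "sinkhorn_potentials \<Lambda> \<nu> U V W (2 * 0 + 1) = (\<lambda>x. U x - ln (f_iter 0 x), \<lambda>y. V y - ln (g_iter (Suc 0) y))"
    using kernel_apply_R[of 0] by (simp add: Let_def ln_div f_iter_0)
next
  case (Suc n)
  show 1: "sinkhorn_potentials \<Lambda> \<nu> U V W (2 * Suc n) = (\<lambda>x. U x - ln (f_iter (Suc n) x), \<lambda>y. V y - ln (g_iter (Suc n) y))"
    using kernel_apply_Q[of "Suc n"] Suc(2) by (simp add: Let_def ln_div)
  show "sinkhorn_potentials \<Lambda> \<nu> U V W (2 * Suc n + 1) = (\<lambda>x. U x - ln (f_iter (Suc n) x), \<lambda>y. V y - ln (g_iter (Suc (Suc n)) y))"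
    using kernel_apply_R[of "Suc n"] 1 by (simp add: Let_def ln_div)
qed

lemma sinkhorn_pi_even_eq: "sinkhorn_pi_even \<Lambda> \<nu> U V W n = it.pi_N n"
proof -
  have "sinkhorn_S_even \<Lambda> \<nu> U V W n x
      = density (tilt \<nu> V) (\<lambda>y. ennreal (exp (- W x y) * f_iter n x * g_iter n y))" for x
  proof -
    have "sinkhorn_S_even \<Lambda> \<nu> U V W n x
        = density (kernel_Q \<nu> W x) (\<lambda>y. ennreal (exp (- (V y - ln (g_iter n y))) / (1 / f_iter n x)))"
      using kernel_apply_Q[of n x]
      by (simp add: sinkhorn_S_even_def normalized_kernel_def sinkhorn_V_def sinkhorn_potentials_eq)
    also have "\<dots> = density \<nu> (\<lambda>y. ennreal (exp (- W x y)) * ennreal (exp (- (V y - ln (g_iter n y))) / (1 / f_iter n x)))"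
      unfolding kernel_Q_def tilt_def by (subst density_density_eq) auto
    also have "\<dots> = density \<nu> (\<lambda>y. ennreal (exp (- V y)) * ennreal (exp (- W x y) * f_iter n x * g_iter n y))"
      using iter_pos
      by (intro density_cong AE_I2) (auto simp: ennreal_mult[symmetric] exp_diff exp_minus less_imp_le field_simps)
    also have "\<dots> = density (tilt \<nu> V) (\<lambda>y. ennreal (exp (- W x y) * f_iter n x * g_iter n y))"
      unfolding tilt_def by (subst density_density_eq) auto
    finally show ?thesis .
  qed
  then have S: "sinkhorn_S_even \<Lambda> \<nu> U V W n
      = (\<lambda>x. density (tilt \<nu> V) (\<lambda>y. ennreal (exp (- W x y) * f_iter n x * g_iter n y)))"
    by (rule ext)
  show ?thesis
    unfolding sinkhorn_pi_even_def S it.pi_N_def it.gs_Suc it.fs_def f_iter_def g_iter_def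
    by (rule it.bind_transition[OF it.weight_gs[of n]])
qed

lemma sinkhorn_pi_odd_eq: "sinkhorn_pi_odd \<Lambda> \<nu> U V W n = it.pi_M n"
proof -
  have "sinkhorn_S_odd \<Lambda> \<nu> U V W n y
      = density (tilt \<Lambda> U) (\<lambda>x. ennreal (exp (- W x y) * g_iter (Suc n) y * f_iter n x))" for y
  proof -
    have "sinkhorn_S_odd \<Lambda> \<nu> U V W n y
        = density (kernel_R \<Lambda> W y) (\<lambda>x. ennreal (exp (- (U x - ln (f_iter n x))) / (1 / g_iter (Suc n) y)))"
      using kernel_apply_R[of n y] sinkhorn_potentials_eq(2)[of n]
      by (simp add: sinkhorn_S_odd_def normalized_kernel_def sinkhorn_U_def del: sinkhorn_potentials.simps)
    also have "\<dots> = density \<Lambda> (\<lambda>x. ennreal (exp (- W x y)) * ennreal (exp (- (U x - ln (f_iter n x))) / (1 / g_iter (Suc n) y)))"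
      unfolding kernel_R_def tilt_def by (subst density_density_eq) auto
    also have "\<dots> = density \<Lambda> (\<lambda>x. ennreal (exp (- U x)) * ennreal (exp (- W x y) * g_iter (Suc n) y * f_iter n x))"
      using iter_pos
      by (intro density_cong AE_I2) (auto simp: ennreal_mult[symmetric] exp_diff exp_minus less_imp_le field_simps)
    also have "\<dots> = density (tilt \<Lambda> U) (\<lambda>x. ennreal (exp (- W x y) * g_iter (Suc n) y * f_iter n x))"
      unfolding tilt_def by (subst density_density_eq) auto
    finally show ?thesis .
  qed
  then have S: "sinkhorn_S_odd \<Lambda> \<nu> U V W n
      = (\<lambda>y. density (tilt \<Lambda> U) (\<lambda>x. ennreal (exp (- W x y) * g_iter (Suc n) y * f_iter n x)))"
    by (rule ext)
  show ?thesis
    unfolding sinkhorn_pi_odd_def S it.pi_M_def it.fs_def[of "Suc n"] it.gs_Suc f_iter_def g_iter_def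
    by (rule it.op.bind_transition[OF it.weight_fs[of n]])
qed

lemma sinkhorn_bridge_eq: "sinkhorn_bridge \<Lambda> \<nu> U V W (2 * n) = it.bridge (it.fs n) (it.gs n)"
proof -
  interpret \<nu>: finite_measure \<nu> by (rule finite_\<nu>)
  have "tilt \<Lambda> U \<Otimes>\<^sub>M tilt \<nu> V = density (\<Lambda> \<Otimes>\<^sub>M \<nu>) (\<lambda>(x, y). ennreal (exp (- U x)) * ennreal (exp (- V y)))"
    unfolding tilt_def
    by (rule pair_measure_density)
       (auto simp: \<nu>.sigma_finite_measure_axioms it.N.sigma_finite_measure_axioms[unfolded tilt_def])
  then have "it.bridge (it.fs n) (it.gs n) = density (\<Lambda> \<Otimes>\<^sub>M \<nu>) (\<lambda>z. (case z of (x, y) \<Rightarrow> ennreal (exp (- U x)) * ennreal (exp (- V y)))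
      * (case z of (x, y) \<Rightarrow> ennreal (exp (- W x y) * f_iter n x * g_iter n y)))"
    unfolding it.bridge_def f_iter_def[symmetric] g_iter_def[symmetric] by (simp only:, subst density_density_eq) auto
  also have "\<dots> = sinkhorn_bridge \<Lambda> \<nu> U V W (2 * n)"
    unfolding sinkhorn_bridge_def sinkhorn_U_def sinkhorn_V_def sinkhorn_potentials_eq
    using iter_pos
    by (intro density_cong AE_I2)
       (auto simp: ennreal_mult[symmetric] exp_diff exp_minus less_imp_le field_simps)
  finally show ?thesis by simp
qed

end

theorem theorem2p2:
  fixes \<Lambda> :: "'a::polish_space measure" and \<nu> :: "'b::polish_space measure"
    and U :: "'a \<Rightarrow> real" and V :: "'b \<Rightarrow> real" and W :: "'a \<Rightarrow> 'b \<Rightarrow> real"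
    and \<Phi> :: "real \<Rightarrow> real \<Rightarrow> ereal"
  assumes "locally_compact_space (euclidean :: 'a topology)"
    and "locally_compact_space (euclidean :: 'b topology)"
    and "sets \<Lambda> = sets borel" and "sets \<nu> = sets borel"
    and "\<And>K. compact K \<Longrightarrow> emeasure \<Lambda> K < \<infinity>"
    and "\<And>K. compact K \<Longrightarrow> emeasure \<nu> K < \<infinity>"
    and "U \<in> borel_measurable borel" and "V \<in> borel_measurable borel"
    and "(\<lambda>(x, y). W x y) \<in> borel_measurable (borel \<Otimes>\<^sub>M borel)"
    and "prob_space (tilt \<Lambda> U)" and "prob_space (tilt \<nu> V)"
    and "\<And>x. prob_space (kernel_Q \<nu> W x)"
    and "\<exists>P \<in> couplings (tilt \<Lambda> U) (tilt \<nu> V). Ent P (sinkhorn_bridge \<Lambda> \<nu> U V W 0) < \<infinity>"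
    and "bounded (range (\<lambda>(x, y). W x y))"
    and "entropy_function \<Phi>"
  shows "\<exists>\<rho> c :: real. 0 < \<rho> \<and> \<rho> < 1 \<and> 0 < c \<and> (\<forall>n :: nat.
     Phi_entropy \<Phi> (sinkhorn_pi_even \<Lambda> \<nu> U V W n) (tilt \<nu> V)
       \<le> ereal (\<rho> ^ n) * Phi_entropy \<Phi> (sinkhorn_pi_even \<Lambda> \<nu> U V W 0) (tilt \<nu> V) \<and>
     Phi_entropy \<Phi> (tilt \<nu> V) (sinkhorn_pi_even \<Lambda> \<nu> U V W n)
       \<le> ereal (\<rho> ^ n) * Phi_entropy \<Phi> (tilt \<nu> V) (sinkhorn_pi_even \<Lambda> \<nu> U V W 0) \<and>
     (n \<ge> 1 \<or> log_deriv_norm (sinkhorn_pi_even \<Lambda> \<nu> U V W 0) (tilt \<nu> V) < \<infinity>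
        \<longrightarrow> log_deriv_norm (sinkhorn_pi_even \<Lambda> \<nu> U V W n) (tilt \<nu> V) \<le> ereal (c * \<rho> ^ n)) \<and>
     (n \<ge> 1 \<or> log_deriv_norm (tilt \<nu> V) (sinkhorn_pi_even \<Lambda> \<nu> U V W 0) < \<infinity>
        \<longrightarrow> log_deriv_norm (tilt \<nu> V) (sinkhorn_pi_even \<Lambda> \<nu> U V W n) \<le> ereal (c * \<rho> ^ n)) \<and>
     Phi_entropy \<Phi> (sinkhorn_pi_odd \<Lambda> \<nu> U V W n) (tilt \<Lambda> U)
       \<le> ereal (\<rho> ^ n) * Phi_entropy \<Phi> (sinkhorn_pi_odd \<Lambda> \<nu> U V W 0) (tilt \<Lambda> U) \<and>
     Phi_entropy \<Phi> (tilt \<Lambda> U) (sinkhorn_pi_odd \<Lambda> \<nu> U V W n)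
       \<le> ereal (\<rho> ^ n) * Phi_entropy \<Phi> (tilt \<Lambda> U) (sinkhorn_pi_odd \<Lambda> \<nu> U V W 0) \<and>
     log_deriv_norm (sinkhorn_pi_odd \<Lambda> \<nu> U V W n) (tilt \<Lambda> U) \<le> ereal (c * \<rho> ^ n) \<and>
     Ent (schroedinger_bridge \<Lambda> \<nu> U V W) (sinkhorn_bridge \<Lambda> \<nu> U V W (2 * n))
       \<le> ereal (c * \<rho> ^ n))"
proof -
  obtain B where B: "\<And>x y. \<bar>W x y\<bar> \<le> B"
    using assms(14) unfolding bounded_iff by force
  interpret bounded_sinkhorn_problem \<Lambda> \<nu> U V W "\<bar>B\<bar> + 1"
  proof (rule bounded_sinkhorn_problem.intro)
    note [measurable_cong] = assms(3,4)
    note [measurable] = assms(7-9)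
    show "space \<Lambda> = UNIV" "space \<nu> = UNIV"
      using sets_eq_imp_space_eq[OF assms(3)] sets_eq_imp_space_eq[OF assms(4)] by simp_all
    show "U \<in> borel_measurable \<Lambda>" "V \<in> borel_measurable \<nu>" by measurable
    show "(\<lambda>(x, y). W x y) \<in> borel_measurable (\<Lambda> \<Otimes>\<^sub>M \<nu>)" by measurable
    show "prob_space (tilt \<Lambda> U)" "prob_space (tilt \<nu> V)" "prob_space (kernel_Q \<nu> W x)" for x
      by (rule assms)+
    show "\<bar>W x y\<bar> \<le> \<bar>B\<bar> + 1" for x y using B[of x y] by linarith
  qed simp
  have bridge_0: "sinkhorn_bridge \<Lambda> \<nu> U V W 0 = it.bridge (it.fs 0) (it.gs 0)"
    using sinkhorn_bridge_eq[of 0] by simp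
  obtain c\<^sub>1 where c\<^sub>1: "0 < c\<^sub>1" and log_norm: "\<forall>n.
    (n \<ge> 1 \<or> log_deriv_norm (it.pi_N 0) (tilt \<nu> V) < \<infinity> \<longrightarrow> log_deriv_norm (it.pi_N n) (tilt \<nu> V) \<le> ereal (c\<^sub>1 * it.rate ^ n)) \<and>
    (n \<ge> 1 \<or> log_deriv_norm (tilt \<nu> V) (it.pi_N 0) < \<infinity> \<longrightarrow> log_deriv_norm (tilt \<nu> V) (it.pi_N n) \<le> ereal (c\<^sub>1 * it.rate ^ n)) \<and>
    log_deriv_norm (it.pi_M n) (tilt \<Lambda> U) \<le> ereal (c\<^sub>1 * it.rate ^ n)"
    using it.log_deriv_norm_pi_decay by blast
  obtain c\<^sub>2 where c\<^sub>2: "0 < c\<^sub>2" and bridge: "\<forall>n. Ent (schroedinger_bridge \<Lambda> \<nu> U V W) (it.bridge (it.fs n) (it.gs n)) \<le> ereal (c\<^sub>2 * it.rate ^ n)"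
    using it.schroedinger_bridge_entropy_decay assms(13) unfolding schroedinger_bridge_def bridge_0 by blast
  have mono: "ereal (c\<^sub>1 * it.rate ^ n) \<le> ereal (max c\<^sub>1 c\<^sub>2 * it.rate ^ n)"
    "ereal (c\<^sub>2 * it.rate ^ n) \<le> ereal (max c\<^sub>1 c\<^sub>2 * it.rate ^ n)" for n
    using it.rate by (auto intro!: mult_right_mono)
  show ?thesis
    unfolding sinkhorn_pi_even_eq sinkhorn_pi_odd_eq sinkhorn_bridge_eq
  proof (rule exI[of _ it.rate], rule exI[of _ "max c\<^sub>1 c\<^sub>2"], intro conjI allI impI)
    fix n
    show "log_deriv_norm (it.pi_N n) (tilt \<nu> V) \<le> ereal (max c\<^sub>1 c\<^sub>2 * it.rate ^ n)"
      if "n \<ge> 1 \<or> log_deriv_norm (it.pi_N 0) (tilt \<nu> V) < \<infinity>"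
      using log_norm that by (intro order_trans[OF _ mono(1)]) blast
    show "log_deriv_norm (tilt \<nu> V) (it.pi_N n) \<le> ereal (max c\<^sub>1 c\<^sub>2 * it.rate ^ n)"
      if "n \<ge> 1 \<or> log_deriv_norm (tilt \<nu> V) (it.pi_N 0) < \<infinity>"
      using log_norm that by (intro order_trans[OF _ mono(1)]) blast
    show "log_deriv_norm (it.pi_M n) (tilt \<Lambda> U) \<le> ereal (max c\<^sub>1 c\<^sub>2 * it.rate ^ n)"
      using log_norm by (intro order_trans[OF _ mono(1)]) blast
    show "Ent (schroedinger_bridge \<Lambda> \<nu> U V W) (it.bridge (it.fs n) (it.gs n)) \<le> ereal (max c\<^sub>1 c\<^sub>2 * it.rate ^ n)"
      using bridge by (intro order_trans[OF _ mono(2)]) blast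
  qed (use it.rate c\<^sub>1 it.Phi_entropy_pi_decay[OF assms(15)] in auto)
qed

end
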